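(* Let $\alpha,K,F$ be positive integers with $K>1$ and $\alpha\in\{1,\dots,F-1\}$. Consider a private $\alpha$-connect PPMA-MADC model with $KF$ mapper nodes, $K$ reducer nodes and $Q=\binom F\alpha$ output functions. Then the $\left(K\binom F\alpha,\;KF,\;(K-1)F+\alpha,\;\binom F{\alpha+1}\right)$ placement delivery array $\mathbf P$ constructed in the context corresponds to this model, and (through the coding scheme based on $\mathbf P$ described in the context, which satisfies the decoding and privacy requirements of the model) it achieves computation load $r=1$ and communication load $$L_p=\frac{F-\alpha}{F\,(K-1)\,(\alpha+1)} .$$
   Context: Notation: $[n]=\{1,\dots,n\}$; $\oplus$ is bitwise XOR; $\mathbf y[i]$ is the $i$-th entry of a vector $\mathbf y$. **Placement delivery array (PDA).** A $(K',F',Z,S)$ PDA is an $F'\times K'$ array with entries in $\{*\}\cup[S]$ such that: each column contains exactly $Z$ symbols $*$; each integer of $[S]$ occurs at least once; and whenever two distinct entries, in positions $(f_1,k_1)$ and $(f_2,k_2)$, equal the same integer, then $f_1\ne f_2$, $k_1\ne k_2$ and the entries in positions $(f_1,k_2)$ and $(f_2,k_1)$ are both $*$. **Multi-access distributed computing (MADC).** There are $N$ files $W_1,\dots,W_N\in\mathbb F_{2^d}$ and $Q$ output functions $\phi_q(W_1,\dots,W_N)=h_q(v_{q,1},\dots,v_{q,N})$, $q\in[Q]$, where $v_{q,n}=g_{q,n}(W_n)\in\mathbb F_{2^\beta}$ is an intermediate value (IV) of $\beta$ bits, with map functions $g_{q,n}:\mathbb F_{2^d}\to\mathbb F_{2^\beta}$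 and reduce functions $h_q:\mathbb F_{2^\beta}^N\to\mathbb F_{2^b}$. There are $\Lambda$ mapper nodes and $K$ reducer nodes $R_1,\dots,R_K$. The files are divided into $\Lambda$ disjoint batches of equal size $N/\Lambda$; each mapper stores exactly one batch (different mappers store different batches) and computes all IVs $v_{q,n}$, $q\in[Q]$, of the files in its batch. A reducer can retrieve the IVs computed by every mapper it is connected to. Each reducer is assigned one output function. **$\alpha$-connect PPMA-MADC (partial private mapper assignment) model.** The mappers are partitioned into $K$ disjoint blocks of equal size, $\mathcal M_1,\dots,\mathcal M_K$; here $\Lambda=KF$ and $\mathcal M_k=\{M_k^f:f\in[F]\}$, and $M_k^f$ stores batch $B_k^f$, which contains $\eta=N/(KF)$ files. The partition is known to all reducers. Reducer $R_k$ is connected to every mapper in every block $\mathcal M_j$, $j\ne k$, and this is known to all reducers. Within its private block $\mathcal M_k$, $R_k$ is connected to exactly $\alpha$ mappers, chosen arbitrarily; these specific connections are private to $R_k$, i.e. not known to the other reducers. Let $\mathcal R_k$ be the set of batches accessible to $R_k$. **Private model.** Reducer $R_k$ is assigned the function $\phi_{d_k}$, $d_k\in[Q]$. Given $d_k$ and $\mathcal R_k$, it generates and broadcasts a query $\mathbf y_k$ to all other reducers. After receiving all queries, each $R_k$ broadcasts a coded message $\mathbf X_k$ to all other reducers. The requirements, for every $k\in[K]$, are: - (Encoding) $H(\mathbf X_k\mid\mathcal R_k,\{\mathbf y_j\}_{j\in[K]})=0$; - (Decoding) $H(\phi_{d_k}\mid\mathcal R_k,d_k,\{\mathbf y_j\}_{j\in[K]},\{\mathbf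 X_j\}_{j\in[K]})=0$; - (Privacy: no other reducer learns $d_k$) $I(\{d_j\}_{j\in[K]};\{\mathbf y_j\}_{j\in[K]}\mid d_k,\mathcal R_k)=0$. **Loads.** The computation load $r$ is the total number of files mapped across the mapper nodes, divided by $N$. The communication load is the total number of bits of the coded messages $\mathbf X_1,\dots,\mathbf X_K$ broadcast by the reducers, divided by the total bit-length $QN\beta$ of all IVs. **The array $\mathbf P$.** Order the $\alpha$-subsets of $[F]$ lexicographically, and likewise the $(\alpha+1)$-subsets; let $y_\alpha(T)$ and $y_{\alpha+1}(Y)$ denote the positions of $T$ and $Y$ in these orders. Let $\mathbf P^{(1)}$ be the $F\times\binom F\alpha$ array with rows indexed by $d\in[F]$, columns indexed by the $\alpha$-subsets $T$ of $[F]$ in lexicographic order, and $(d,T)$ entry equal to $*$ if $d\in T$ and to $y_{\alpha+1}(T\cup\{d\})$ if $d\notin T$. Then $\mathbf P$ is the $K\times K$ block array whose diagonal blocks all equal $\mathbf P^{(1)}$ and whose off-diagonal blocks are the $F\times\binom F\alpha$ array with all entries $*$. Put $S=\binom F{\alpha+1}$, the number of integers in $\mathbf P$. **Correspondence of $\mathbf P$ with the model.** The $f$-th row of row block $k$ represents mapper $M_k^f$ and batch $B_k^f$. The $j$-th column of column block $k$ represents an "effective" reducer $R_k^j$, $j\in[Q]$; a $*$ in a column means that the batch of that row is accessible to the effective reducer of that column. If $R_k$ is connected, inside $\mathcal M_k$, to the mappers $M_k^f$, $f\in T$, $|T|=\alpha$, put $a_k=y_\alpha(T)$; the real reducer $R_k$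 plays the role of $R_k^{a_k}$, whose column has its stars exactly in the rows of the batches in $\mathcal R_k$. The other columns of block $k$ represent virtual reducers. **Coding scheme based on $\mathbf P$.** Reducer $R_k$ takes as query $\mathbf y_k$ a uniformly random permutation of $[Q]$ subject to $\mathbf y_k[a_k]=d_k$; $\mathbf y_k[i]$ is viewed as the function index assigned to $R_k^i$. For $k\in[K]$, $f\in[F]$, $i\in[Q]$ with $\mathbf P^{(1)}_{f,i}\ne *$, let $U_{\mathbf y_k[i],B_k^f}=(v_{\mathbf y_k[i],n}:W_n\in B_k^f)$, a string of $\eta\beta$ bits, partitioned into $K-1$ equally sized packets $U^{l}_{\mathbf y_k[i],B_k^f}$, $l\in[K]\setminus\{k\}$. Reducer $R_k$ broadcasts $\mathbf X_k=\{X_k^t:t\in[S]\}$, where $$X_k^t=\bigoplus_{\substack{j\in[K]\setminus\{k\},\ f\in[F],\ i\in[Q]\\ \mathbf P^{(1)}_{f,i}=t}}U^{k}_{\mathbf y_j[i],B_j^f}.$$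
   Formalization: The private connections, "chosen arbitrarily" in the model, are taken uniform over α-subsets, independent across reducers and of files and demands (with fixed connections the queries reveal the demands); K−1 is assumed to divide the batch length ηβ so that equal packets exist. *)

theory Defs
  imports "HOL-Probability.Probability" "HOL-Library.Ramsey"
begin

section \<open>Placement delivery arrays and the array \<open>P\<close>\<close>

text \<open>All index ranges \<open>[n]\<close> are \<open>{1..n}\<close>. Arrays are functions of a row index and a column index
  whose values outside the index ranges are irrelevant.\<close>

datatype entry = Star | Num nat

definition is_pda :: "nat \<Rightarrow> nat \<Rightarrow> nat \<Rightarrow> nat \<Rightarrow> (nat \<Rightarrow> nat \<Rightarrow> entry) \<Rightarrow> bool" where
  "is_pda K' F' Z S A \<longleftrightarrow>
     (\<forall>f\<in>{1..F'}. \<forall>k\<in>{1..K'}. A f k \<in> insert Star (Num ` {1..S})) \<and>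
     (\<forall>k\<in>{1..K'}. card {f \<in> {1..F'}. A f k = Star} = Z) \<and>
     (\<forall>s\<in>{1..S}. \<exists>f\<in>{1..F'}. \<exists>k\<in>{1..K'}. A f k = Num s) \<and>
     (\<forall>f\<^sub>1\<in>{1..F'}. \<forall>f\<^sub>2\<in>{1..F'}. \<forall>k\<^sub>1\<in>{1..K'}. \<forall>k\<^sub>2\<in>{1..K'}. \<forall>s.
        (f\<^sub>1, k\<^sub>1) \<noteq> (f\<^sub>2, k\<^sub>2) \<and> A f\<^sub>1 k\<^sub>1 = Num s \<and> A f\<^sub>2 k\<^sub>2 = Num s \<longrightarrow>
        f\<^sub>1 \<noteq> f\<^sub>2 \<and> k\<^sub>1 \<noteq> k\<^sub>2 \<and> A f\<^sub>1 k\<^sub>2 = Star \<and> A f\<^sub>2 k\<^sub>1 = Star)"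

text \<open>The (1-based) position of \<open>T\<close> among the \<open>a\<close>-subsets of \<open>[F]\<close> in lexicographic order, and
  its inverse.\<close>

definition lex_pos :: "nat \<Rightarrow> nat \<Rightarrow> nat set \<Rightarrow> nat" where
  "lex_pos F a T =
     Suc (card {T' \<in> nsets {1..F} a.
       (sorted_list_of_set T', sorted_list_of_set T) \<in> lexord less_than})"

definition nth_subset :: "nat \<Rightarrow> nat \<Rightarrow> nat \<Rightarrow> nat set" where
  "nth_subset F a i = (THE T. T \<in> nsets {1..F} a \<and> lex_pos F a T = i)"

definition P1 :: "nat \<Rightarrow> nat \<Rightarrow> nat \<Rightarrow> nat \<Rightarrow> entry" where
  "P1 F \<alpha> d i =
     (let T = nth_subset F \<alpha> i
      in if d \<in> T then Star else Num (lex_pos F (Suc \<alpha>) (insert d T)))"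

text \<open>In a block array with blocks of size \<open>n\<close>, line \<open>i\<close> of block \<open>k\<close> has the global index
  \<open>block_index n k i\<close>; conversely the global index \<open>x\<close> is line \<open>(x - 1) mod n + 1\<close> of block
  \<open>(x - 1) div n + 1\<close>.\<close>

definition block_index :: "nat \<Rightarrow> nat \<Rightarrow> nat \<Rightarrow> nat" where
  "block_index n k i = (k - 1) * n + i"

definition P_array :: "nat \<Rightarrow> nat \<Rightarrow> nat \<Rightarrow> nat \<Rightarrow> entry" where
  "P_array F \<alpha> x c =
     (if (x - 1) div F = (c - 1) div (F choose \<alpha>)
      then P1 F \<alpha> (Suc ((x - 1) mod F)) (Suc ((c - 1) mod (F choose \<alpha>)))
      else Star)"

section \<open>The PPMA-MADC model\<close>

text \<open>The mapper \<open>M_k^f\<close>, and the batch \<open>B_k^f\<close> stored by it, have the index \<open>(k, f)\<close>. The fields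
  \<open>\<F>(2^d)\<close>, \<open>\<F>(2^\<beta>)\<close> and \<open>\<F>(2^b)\<close> of files, intermediate values and outputs are the types \<open>'w\<close>,
  \<open>'v\<close> and \<open>'o\<close>; \<open>d\<close>, \<open>\<beta>\<close> and \<open>b\<close> are \<open>file_len\<close>, \<open>iv_len\<close> and \<open>out_len\<close>. The map \<open>iv_rep\<close> is the
  identification of \<open>\<F>(2^\<beta>)\<close> with the strings of \<open>\<beta>\<close> bits.\<close>

record ('w, 'v, 'o) madc =
  n_files :: nat
  n_funcs :: nat
  file_len :: nat
  iv_len :: nat
  out_len :: nat
  batch :: "nat \<Rightarrow> nat \<Rightarrow> nat set"
  map_fn :: "nat \<Rightarrow> nat \<Rightarrow> 'w \<Rightarrow> 'v"
  reduce_fn :: "nat \<Rightarrow> (nat \<Rightarrow> 'v) \<Rightarrow> 'o"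
  iv_rep :: "'v \<Rightarrow> bool list"

definition ppma_madc ::
  "nat \<Rightarrow> nat \<Rightarrow> ('w::{field,finite}, 'v::{field,finite}, 'o::{field,finite}) madc \<Rightarrow> bool" where
  "ppma_madc K F m \<longleftrightarrow>
     n_files m > 0 \<and> K * F dvd n_files m \<and>
     CARD('w) = 2 ^ file_len m \<and> CARD('v) = 2 ^ iv_len m \<and> CARD('o) = 2 ^ out_len m \<and>
     bij_betw (iv_rep m) UNIV {bs. length bs = iv_len m} \<and>
     (\<forall>k\<in>{1..K}. \<forall>f\<in>{1..F}. card (batch m k f) = n_files m div (K * F)) \<and>
     disjoint_family_on (\<lambda>(k, f). batch m k f) ({1..K} \<times> {1..F}) \<and>
     (\<Union>k\<in>{1..K}. \<Union>f\<in>{1..F}. batch m k f) = {1..n_files m}"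

definition iv :: "('w, 'v, 'o) madc \<Rightarrow> (nat \<Rightarrow> 'w) \<Rightarrow> nat \<Rightarrow> nat \<Rightarrow> 'v" where
  "iv m w q n = map_fn m q n (w n)"

definition output_fn :: "('w, 'v, 'o) madc \<Rightarrow> (nat \<Rightarrow> 'w) \<Rightarrow> nat \<Rightarrow> 'o" where
  "output_fn m w q = reduce_fn m q (\<lambda>n\<in>{1..n_files m}. iv m w q n)"

text \<open>The mappers that \<open>R_k\<close> is connected to if it is connected to the mappers \<open>M_k^f\<close>, \<open>f \<in> T\<close>, of
  its private block.\<close>

definition accessible :: "nat \<Rightarrow> nat \<Rightarrow> nat \<Rightarrow> nat set \<Rightarrow> (nat \<times> nat) set" where
  "accessible K F k T = {(j, f). j \<in> {1..K} \<and> f \<in> {1..F} \<and> (j \<noteq> k \<or> f \<in> T)}"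

text \<open>The value of \<open>\<R>_k\<close>: the accessible batches, each given by its index together with the
  contents of its files.\<close>

definition accessible_batches ::
  "nat \<Rightarrow> nat \<Rightarrow> ('w, 'v, 'o) madc \<Rightarrow> nat \<Rightarrow> nat set \<Rightarrow> (nat \<Rightarrow> 'w) \<Rightarrow>
   ((nat \<times> nat) \<times> (nat \<Rightarrow> 'w)) set" where
  "accessible_batches K F m k T w =
     (\<lambda>(j, f). ((j, f), restrict w (batch m j f))) ` accessible K F k T"

text \<open>An array corresponds to the model if its rows represent the mappers, the columns of its
  \<open>k\<close>-th column block represent the possible private connections of \<open>R_k\<close>, and the stars of
  each such column lie exactly in the rows of the mappers (batches) then accessible to \<open>R_k\<close>.\<close>

definition corresponds ::
  "nat \<Rightarrow> nat \<Rightarrow> nat \<Rightarrow> ('w, 'v, 'o) madc \<Rightarrow> (nat \<Rightarrow> nat \<Rightarrow> entry) \<Rightarrow> bool" where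
  "corresponds K F \<alpha> m A \<longleftrightarrow>
     bij_betw (\<lambda>(j, f). block_index F j f) ({1..K} \<times> {1..F}) {1..K * F} \<and>
     bij_betw (\<lambda>(k, i). block_index (n_funcs m) k i)
       ({1..K} \<times> {1..n_funcs m}) {1..K * n_funcs m} \<and>
     bij_betw (lex_pos F \<alpha>) (nsets {1..F} \<alpha>) {1..n_funcs m} \<and>
     (\<forall>k\<in>{1..K}. \<forall>T\<in>nsets {1..F} \<alpha>. \<forall>j\<in>{1..K}. \<forall>f\<in>{1..F}.
        A (block_index F j f) (block_index (n_funcs m) k (lex_pos F \<alpha> T)) = Star \<longleftrightarrow>
        (j, f) \<in> accessible K F k T)"

section \<open>The private model\<close>

text \<open>One realisation of the files, the demands \<open>d_k\<close>, the private connections (the sets \<open>T\<close>) and the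
  queries.\<close>

record ('w, 'y) outcome =
  files :: "nat \<Rightarrow> 'w"
  demand :: "nat \<Rightarrow> nat"
  conn :: "nat \<Rightarrow> nat set"
  query :: "nat \<Rightarrow> 'y"

text \<open>The joint law. Files and demands follow an arbitrary law \<open>p\<close>. The connections being private
  means that they are uniform and independent of each other and of the files and demands; without
  randomness in the connections, the queries of the coding scheme below would reveal the demands.
  Each \<open>R_k\<close> draws its query independently from a distribution \<open>\<kappa> k\<close> depending on \<open>d_k\<close> and \<open>\<R>_k\<close>.\<close>

definition joint_law ::
  "nat \<Rightarrow> nat \<Rightarrow> nat \<Rightarrow> ('w, 'v, 'o) madc \<Rightarrow>
   (nat \<Rightarrow> nat \<Rightarrow> ((nat \<times> nat) \<times> (nat \<Rightarrow> 'w)) set \<Rightarrow> 'y pmf) \<Rightarrow>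
   ((nat \<Rightarrow> 'w) \<times> (nat \<Rightarrow> nat)) pmf \<Rightarrow> ('w, 'y) outcome pmf" where
  "joint_law K F \<alpha> m \<kappa> p = do {
     (w, d) \<leftarrow> p;
     T \<leftarrow> Pi_pmf {1..K} undefined (\<lambda>_. pmf_of_set (nsets {1..F} \<alpha>));
     y \<leftarrow> Pi_pmf {1..K} undefined (\<lambda>k. \<kappa> k (d k) (accessible_batches K F m k (T k) w));
     return_pmf \<lparr>files = w, demand = d, conn = T, query = y\<rparr>
   }"

text \<open>Entropies (in bits) on the finite probability space \<open>set_pmf p\<close>. The library functions need the
  carrier of the space to be finite, which rules out using \<open>measure_pmf p\<close> itself.\<close>

definition outcome_space :: "'a pmf \<Rightarrow> 'a measure" where
  "outcome_space p = point_measure (set_pmf p) (\<lambda>x. ennreal (pmf p x))"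

definition cond_H :: "'a pmf \<Rightarrow> ('a \<Rightarrow> 'b) \<Rightarrow> ('a \<Rightarrow> 'c) \<Rightarrow> real" where
  "cond_H p X Y = prob_space.conditional_entropy (outcome_space p) 2
     (count_space (X ` set_pmf p)) (count_space (Y ` set_pmf p)) X Y"

definition cond_I :: "'a pmf \<Rightarrow> ('a \<Rightarrow> 'b) \<Rightarrow> ('a \<Rightarrow> 'c) \<Rightarrow> ('a \<Rightarrow> 'd) \<Rightarrow> real" where
  "cond_I p X Y Z = prob_space.conditional_mutual_information (outcome_space p) 2
     (count_space (X ` set_pmf p)) (count_space (Y ` set_pmf p)) (count_space (Z ` set_pmf p)) X Y Z"

definition known_batches ::
  "nat \<Rightarrow> nat \<Rightarrow> ('w, 'v, 'o) madc \<Rightarrow> nat \<Rightarrow> ('w, 'y) outcome \<Rightarrow>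
   ((nat \<times> nat) \<times> (nat \<Rightarrow> 'w)) set" where
  "known_batches K F m k \<omega> = accessible_batches K F m k (conn \<omega> k) (files \<omega>)"

definition encoding_req ::
  "nat \<Rightarrow> nat \<Rightarrow> ('w, 'v, 'o) madc \<Rightarrow> ('w, 'y) outcome pmf \<Rightarrow>
   (nat \<Rightarrow> ('w, 'y) outcome \<Rightarrow> 'x) \<Rightarrow> bool" where
  "encoding_req K F m p X \<longleftrightarrow>
     (\<forall>k\<in>{1..K}. cond_H p (X k)
        (\<lambda>\<omega>. (known_batches K F m k \<omega>, \<lambda>j\<in>{1..K}. query \<omega> j)) = 0)"

definition decoding_req ::
  "nat \<Rightarrow> nat \<Rightarrow> ('w, 'v, 'o) madc \<Rightarrow> ('w, 'y) outcome pmf \<Rightarrow>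
   (nat \<Rightarrow> ('w, 'y) outcome \<Rightarrow> 'x) \<Rightarrow> bool" where
  "decoding_req K F m p X \<longleftrightarrow>
     (\<forall>k\<in>{1..K}. cond_H p (\<lambda>\<omega>. output_fn m (files \<omega>) (demand \<omega> k))
        (\<lambda>\<omega>. (known_batches K F m k \<omega>, demand \<omega> k,
               \<lambda>j\<in>{1..K}. query \<omega> j, \<lambda>j\<in>{1..K}. X j \<omega>)) = 0)"

definition privacy_req ::
  "nat \<Rightarrow> nat \<Rightarrow> ('w, 'v, 'o) madc \<Rightarrow> ('w, 'y) outcome pmf \<Rightarrow> bool" where
  "privacy_req K F m p \<longleftrightarrow>
     (\<forall>k\<in>{1..K}. cond_I p (\<lambda>\<omega>. \<lambda>j\<in>{1..K}. demand \<omega> j) (\<lambda>\<omega>. \<lambda>j\<in>{1..K}. query \<omega> j)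
        (\<lambda>\<omega>. (demand \<omega> k, known_batches K F m k \<omega>)) = 0)"

definition computation_load :: "nat \<Rightarrow> nat \<Rightarrow> ('w, 'v, 'o) madc \<Rightarrow> real" where
  "computation_load K F m =
     real (\<Sum>k\<in>{1..K}. \<Sum>f\<in>{1..F}. card (batch m k f)) / real (n_files m)"

text \<open>The communication load of a realisation \<open>\<omega>\<close>, for messages consisting of lists of bit strings.\<close>

definition communication_load ::
  "nat \<Rightarrow> ('w, 'v, 'o) madc \<Rightarrow> (nat \<Rightarrow> ('w, 'y) outcome \<Rightarrow> bool list list) \<Rightarrow>
   ('w, 'y) outcome \<Rightarrow> real" where
  "communication_load K m X \<omega> =
     real (\<Sum>k\<in>{1..K}. length (concat (X k \<omega>))) / real (n_funcs m * n_files m * iv_len m)"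

section \<open>The coding scheme based on \<open>P\<close>\<close>

text \<open>A query, a vector of length \<open>Q\<close>, is a permutation of \<open>{1..Q}\<close>. The index \<open>a_k\<close> is read off from
  the batches of block \<open>k\<close> occurring in \<open>\<R>_k\<close>.\<close>

definition scheme_query ::
  "nat \<Rightarrow> nat \<Rightarrow> ('w, 'v, 'o) madc \<Rightarrow> nat \<Rightarrow> nat \<Rightarrow>
   ((nat \<times> nat) \<times> (nat \<Rightarrow> 'w)) set \<Rightarrow> (nat \<Rightarrow> nat) pmf" where
  "scheme_query F \<alpha> m k d R =
     (let a = lex_pos F \<alpha> {f. (k, f) \<in> fst ` R}
      in pmf_of_set {\<pi>. \<pi> permutes {1..n_funcs m} \<and> \<pi> a = d})"

definition batch_string ::
  "('w, 'v, 'o) madc \<Rightarrow> (nat \<Rightarrow> 'w) \<Rightarrow> nat \<Rightarrow> nat \<Rightarrow> nat \<Rightarrow> bool list" where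
  "batch_string m w q k f =
     concat (map (\<lambda>n. iv_rep m (iv m w q n)) (sorted_list_of_set (batch m k f)))"

definition packet_len :: "nat \<Rightarrow> nat \<Rightarrow> ('w, 'v, 'o) madc \<Rightarrow> nat" where
  "packet_len K F m = n_files m div (K * F) * iv_len m div (K - 1)"

text \<open>The strings of batches of block \<open>k\<close> are cut into \<open>K - 1\<close> consecutive packets, which are
  labelled by the elements \<open>l\<close> of \<open>[K] - {k}\<close> in increasing order.\<close>

definition packet ::
  "nat \<Rightarrow> nat \<Rightarrow> ('w, 'v, 'o) madc \<Rightarrow> (nat \<Rightarrow> 'w) \<Rightarrow> nat \<Rightarrow> nat \<Rightarrow> nat \<Rightarrow> nat \<Rightarrow> bool list" where
  "packet K F m w l q k f =
     take (packet_len K F m)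
       (drop (card {l' \<in> {1..K} - {k}. l' < l} * packet_len K F m) (batch_string m w q k f))"

definition xor_all :: "nat \<Rightarrow> bool list list \<Rightarrow> bool list" where
  "xor_all n bss = foldr (map2 (\<noteq>)) bss (replicate n False)"

definition scheme_message ::
  "nat \<Rightarrow> nat \<Rightarrow> nat \<Rightarrow> ('w, 'v, 'o) madc \<Rightarrow> nat \<Rightarrow> ('w, nat \<Rightarrow> nat) outcome \<Rightarrow>
   bool list list" where
  "scheme_message K F \<alpha> m k \<omega> =
     map (\<lambda>t. xor_all (packet_len K F m)
            [packet K F m (files \<omega>) k (query \<omega> j i) j f.
               j \<leftarrow> [1..<Suc K], j \<noteq> k, f \<leftarrow> [1..<Suc F], i \<leftarrow> [1..<Suc (n_funcs m)],
               P1 F \<alpha> f i = Num t])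
       [1..<Suc (F choose (\<alpha> + 1))]"

end

theory Submission
  imports Defs
begin

text \<open>
  Two equal integers in different columns of a block of \<open>P\<close> satisfy \<open>T \<union> {d} = T' \<union> {d'}\<close> with
  \<open>d \<in> T'\<close> and \<open>d' \<in> T\<close>, which gives the array property. For the same reason, of the packets XORed
  in \<open>X_l^t\<close>, where \<open>t\<close> is the integer in a non-star entry of the column \<open>a_k\<close>, reducer \<open>R_k\<close> lacks
  only the one of that entry; hence two outcomes which look the same to \<open>R_k\<close> have the same missing
  packets. Since a conditional entropy vanishes if the first variable is determined by the second on
  the support, this settles encoding and decoding. Privacy holds because a uniformly random
  permutation \<open>\<pi>\<close> with \<open>\<pi>(a) = d\<close>, for a uniformly random position \<open>a\<close>, is a uniformly random
  permutation whatever \<open>d\<close> is.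
\<close>

section \<open>Conditional entropy and mutual information on finite supports\<close>

text \<open>Bridge from the point measure, on which the entropies are defined, to the pmf calculus:
  through it the densities become values of \<open>map_pmf\<close>.\<close>

lemma measure_outcome_space_vimage:
  assumes "finite (set_pmf p)"
  shows "measure (outcome_space p) (X -` {x} \<inter> set_pmf p) = pmf (map_pmf X p) x"
proof -
  have "measure (outcome_space p) (X -` {x} \<inter> set_pmf p) = sum (pmf p) (X -` {x} \<inter> set_pmf p)"
    unfolding outcome_space_def
    by (simp add: measure_def emeasure_point_measure_finite assms sum_nonneg)
  also have "\<dots> = measure p (X -` {x} \<inter> set_pmf p)"
    by (rule measure_measure_pmf_finite[symmetric]) (use assms in auto)
  also have "\<dots> = pmf (map_pmf X p) x"
    by (simp add: pmf_map measure_Int_set_pmf)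
  finally show ?thesis .
qed

lemma information_space_outcome_space:
  assumes "finite (set_pmf p)"
  shows "information_space (outcome_space p) 2"
proof -
  have "(\<Sum>x\<in>set_pmf p. ennreal (pmf p x)) = ennreal (\<Sum>x\<in>set_pmf p. pmf p x)"
    by (rule sum_ennreal) simp
  also have "\<dots> = 1"
    by (subst sum_pmf_eq_1) (use assms in simp_all)
  finally interpret prob_space "outcome_space p"
    unfolding outcome_space_def by (intro prob_space_point_measure assms) simp_all
  show ?thesis
    by unfold_locales simp
qed

text \<open>Supplies, for every random variable at once, the density facts that the finite-sum
  formulas for conditional entropy and conditional mutual information ask for.\<close>

lemma simple_distributed_outcome_space:
  assumes "finite (set_pmf p)"
  shows "simple_distributed (outcome_space p) X (pmf (map_pmf X p))"
proof -
  interpret information_space "outcome_space p" 2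
    by (rule information_space_outcome_space) fact
  have space: "space (outcome_space p) = set_pmf p"
    by (simp add: outcome_space_def space_point_measure)
  show ?thesis
  proof (rule simple_distributedI)
    show "simple_function (outcome_space p) X"
      using assms by (simp add: outcome_space_def)
  qed (simp_all add: space measure_outcome_space_vimage assms)
qed

text \<open>On the support, the fibre of \<open>(X, Y)\<close> over a value equals the fibre of
  \<open>Y\<close>, so every logarithm is taken of 1. Comparing two outcomes with the same
  \<open>Y\<close> spares exhibiting an explicit decoder.\<close>

lemma cond_H_eq_0:
  assumes fin: "finite (set_pmf p)"
    and det: "\<And>\<omega> \<omega>'. \<omega> \<in> set_pmf p \<Longrightarrow> \<omega>' \<in> set_pmf p \<Longrightarrow> Y \<omega> = Y \<omega>' \<Longrightarrow> X \<omega> = X \<omega>'"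
  shows "cond_H p X Y = 0"
proof -
  interpret information_space "outcome_space p" 2
    by (rule information_space_outcome_space) fact
  have space: "space (outcome_space p) = set_pmf p"
    by (simp add: outcome_space_def space_point_measure)
  have eq: "pmf (map_pmf (\<lambda>\<omega>. (X \<omega>, Y \<omega>)) p) (X \<omega>, Y \<omega>) = pmf (map_pmf Y p) (Y \<omega>)"
    if "\<omega> \<in> set_pmf p" for \<omega>
  proof -
    have "(\<lambda>\<omega>. (X \<omega>, Y \<omega>)) -` {(X \<omega>, Y \<omega>)} \<inter> set_pmf p = Y -` {Y \<omega>} \<inter> set_pmf p"
      using det that by blast
    then show ?thesis
      by (simp flip: measure_outcome_space_vimage[OF fin])
  qed
  have "cond_H p X Y = - (\<Sum>(x, y)\<in>(\<lambda>\<omega>. (X \<omega>, Y \<omega>)) ` set_pmf p.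
      pmf (map_pmf (\<lambda>\<omega>. (X \<omega>, Y \<omega>)) p) (x, y) *
      log 2 (pmf (map_pmf (\<lambda>\<omega>. (X \<omega>, Y \<omega>)) p) (x, y) / pmf (map_pmf Y p) y))"
    unfolding cond_H_def
    using conditional_entropy_eq[where X = X and Y = Y,
        OF simple_distributed_outcome_space[OF fin] simple_distributed_outcome_space[OF fin]]
    by (simp only: space)
  also have "\<dots> = 0"
  proof -
    have "pmf (map_pmf (\<lambda>\<omega>. (X \<omega>, Y \<omega>)) p) (X \<omega>, Y \<omega>) *
        log 2 (pmf (map_pmf (\<lambda>\<omega>. (X \<omega>, Y \<omega>)) p) (X \<omega>, Y \<omega>) / pmf (map_pmf Y p) (Y \<omega>)) = 0"
      if "\<omega> \<in> set_pmf p" for \<omega>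
      \<comment> \<open>For zero mass the first factor vanishes; otherwise the quotient is
        1.\<close>
      unfolding eq[OF that] by (cases "pmf (map_pmf Y p) (Y \<omega>) = 0") auto
    then show ?thesis
      by (intro iffD2[OF neg_equal_0_iff_equal] sum.neutral) auto
  qed
  finally show ?thesis .
qed

text \<open>Since the drawn value is kept as the first component, only the draw \<open>a\<close>
  contributes to the mass of \<open>(a, b)\<close>.\<close>

lemma pmf_bind_map_Pair:
  "pmf (bind_pmf M (\<lambda>a. map_pmf (Pair a) (f a))) (a, b) = pmf M a * pmf (f a) b"
proof -
  have "pmf (map_pmf (Pair a') (f a')) (a, b) = indicator {a} a' * pmf (f a) b" for a'
  proof (cases "a' = a")
    case True
    then show ?thesis by (simp add: pmf_map_inj' inj_on_def)
  next
    case False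
    then have "(a, b) \<notin> set_pmf (map_pmf (Pair a') (f a'))" by auto
    then have "pmf (map_pmf (Pair a') (f a')) (a, b) = 0"
      by (rule pmf_eq_0_set_pmf[THEN iffD2])
    with False show ?thesis by simp
  qed
  then show ?thesis
    by (simp add: pmf_bind measure_pmf_single)
qed

text \<open>The hypothesis \<open>law\<close> says that \<open>X\<close> and \<open>Z\<close> are
  drawn first and \<open>Y\<close> then from a kernel \<open>g\<close> that sees only
  \<open>Z\<close>, so that X - Z - Y is a Markov chain. The joint mass factors accordingly, and in
  every nonzero term the logarithm is taken of 1.\<close>

lemma cond_I_eq_0:
  assumes fin: "finite (set_pmf p)"
    and law: "map_pmf (\<lambda>\<omega>. ((X \<omega>, Z \<omega>), Y \<omega>)) p =
      bind_pmf \<mu> (\<lambda>a. map_pmf (Pair a) (g (snd a)))"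
  shows "cond_I p X Y Z = 0"
proof -
  interpret information_space "outcome_space p" 2
    by (rule information_space_outcome_space) fact
  have space: "space (outcome_space p) = set_pmf p"
    by (simp add: outcome_space_def space_point_measure)
  define \<nu> where "\<nu> = map_pmf snd \<mu>"
  have XZ: "map_pmf (\<lambda>\<omega>. (X \<omega>, Z \<omega>)) p = \<mu>"
  proof -
    have "map_pmf (\<lambda>\<omega>. (X \<omega>, Z \<omega>)) p = map_pmf fst (map_pmf (\<lambda>\<omega>. ((X \<omega>, Z \<omega>), Y \<omega>)) p)"
      by (simp add: map_pmf_comp)
    also have "\<dots> = \<mu>"
      unfolding law by (simp add: map_bind_pmf map_pmf_comp bind_return_pmf')
    finally show ?thesis .
  qed
  have Z: "map_pmf Z p = \<nu>"
    unfolding \<nu>_def XZ[symmetric] by (simp add: map_pmf_comp)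
  have ZY: "map_pmf (\<lambda>\<omega>. (Z \<omega>, Y \<omega>)) p = bind_pmf \<nu> (\<lambda>z. map_pmf (Pair z) (g z))"
  proof -
    have "map_pmf (\<lambda>\<omega>. (Z \<omega>, Y \<omega>)) p =
        map_pmf (\<lambda>(a, y). (snd a, y)) (map_pmf (\<lambda>\<omega>. ((X \<omega>, Z \<omega>), Y \<omega>)) p)"
      by (simp add: map_pmf_comp)
    also have "\<dots> = bind_pmf \<nu> (\<lambda>z. map_pmf (Pair z) (g z))"
      unfolding law \<nu>_def by (simp add: map_bind_pmf map_pmf_comp bind_map_pmf)
    finally show ?thesis .
  qed
  have pYZ: "pmf (map_pmf (\<lambda>\<omega>. (Y \<omega>, Z \<omega>)) p) (y, z) = pmf \<nu> z * pmf (g z) y" for y z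
  proof -
    have "pmf (map_pmf (\<lambda>\<omega>. (Y \<omega>, Z \<omega>)) p) (y, z) = pmf (map_pmf (\<lambda>\<omega>. (Z \<omega>, Y \<omega>)) p) (z, y)"
      by (auto simp: pmf_map vimage_def intro!: arg_cong[where f = "measure _"])
    then show ?thesis by (simp add: ZY pmf_bind_map_Pair)
  qed
  have pXYZ: "pmf (map_pmf (\<lambda>\<omega>. (X \<omega>, Y \<omega>, Z \<omega>)) p) (x, y, z) = pmf \<mu> (x, z) * pmf (g z) y" for x y z
  proof -
    have "pmf (map_pmf (\<lambda>\<omega>. (X \<omega>, Y \<omega>, Z \<omega>)) p) (x, y, z) =
        pmf (map_pmf (\<lambda>\<omega>. ((X \<omega>, Z \<omega>), Y \<omega>)) p) ((x, z), y)"
      by (auto simp: pmf_map vimage_def intro!: arg_cong[where f = "measure _"])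
    then show ?thesis by (simp add: law pmf_bind_map_Pair)
  qed
  \<comment> \<open>Positivity of \<open>pmf \<nu> z\<close> permits cancelling it in the argument
    of the logarithm.\<close>
  have nz: "pmf \<nu> z > 0" if "pmf \<mu> (x, z) \<noteq> 0" for x z
  proof -
    have "(x, z) \<in> set_pmf \<mu>" using that by (simp add: set_pmf_iff)
    then have "z \<in> set_pmf \<nu>" unfolding \<nu>_def by force
    then show ?thesis by (rule pmf_positive)
  qed
  have "cond_I p X Y Z = (\<Sum>(x, y, z)\<in>(\<lambda>\<omega>. (X \<omega>, Y \<omega>, Z \<omega>)) ` set_pmf p.
      (pmf \<mu> (x, z) * pmf (g z) y) *
      log 2 ((pmf \<mu> (x, z) * pmf (g z) y) /
        (pmf \<mu> (x, z) * ((pmf \<nu> z * pmf (g z) y) / pmf \<nu> z))))"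
    unfolding cond_I_def
    using conditional_mutual_information_eq[where X = X and Y = Y and Z = Z,
        OF simple_distributed_outcome_space[OF fin]
        simple_distributed_outcome_space[OF fin] simple_distributed_outcome_space[OF fin]
        simple_distributed_outcome_space[OF fin]]
    by (simp only: space pYZ pXYZ Z XZ)
  also have "\<dots> = 0"
  proof (intro sum.neutral ballI, clarify)
    fix x y z
    show "(pmf \<mu> (x, z) * pmf (g z) y) *
      log 2 ((pmf \<mu> (x, z) * pmf (g z) y) /
        (pmf \<mu> (x, z) * ((pmf \<nu> z * pmf (g z) y) / pmf \<nu> z))) = 0"
    proof (cases "pmf \<mu> (x, z) = 0 \<or> pmf (g z) y = 0")
      case False
      with nz[of x z] show ?thesis by simp
    qed auto
  qed
  finally show ?thesis .
qed

section \<open>The array \<open>P\<close>\<close>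

text \<open>The rank increases strictly along \<open>r\<close>, hence is injective, and it is at
  most \<open>card A\<close> because no element precedes itself; counting gives surjectivity. It
  serves both for the lexicographic numbering of subsets and for the numbering of packet
  labels.\<close>

lemma bij_betw_rank:
  assumes fin: "finite A" and irr: "\<And>x. \<not> r x x"
    and tr: "\<And>x y z. r x y \<Longrightarrow> r y z \<Longrightarrow> r x z"
    and tot: "\<And>x y. x \<in> A \<Longrightarrow> y \<in> A \<Longrightarrow> x \<noteq> y \<Longrightarrow> r x y \<or> r y x"
  shows "bij_betw (\<lambda>x. Suc (card {y \<in> A. r y x})) A {1..card A}"
proof -
  let ?f = "\<lambda>x. Suc (card {y \<in> A. r y x})"
  have less: "?f x < ?f y" if "x \<in> A" "y \<in> A" "r x y" for x y
  proof -
    have "{z \<in> A. r z x} \<subset> {z \<in> A. r z y}"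
      using that irr tr by blast
    then show ?thesis using fin by (simp add: psubset_card_mono)
  qed
  have inj: "inj_on ?f A"
  proof (rule inj_onI, rule ccontr)
    fix x y assume "x \<in> A" "y \<in> A" "?f x = ?f y" "x \<noteq> y"
    with tot[of x y] less[of x y] less[of y x] show False by linarith
  qed
  have "?f ` A \<subseteq> {1..card A}"
  proof clarify
    fix x assume "x \<in> A"
    then have "{y \<in> A. r y x} \<subset> A" using irr by blast
    then show "?f x \<in> {1..card A}" using fin by (simp add: psubset_card_mono Suc_le_eq)
  qed
  moreover have "card (?f ` A) = card {1..card A}"
    using card_image[OF inj] by simp
  ultimately have "?f ` A = {1..card A}"
    by (intro card_subset_eq) auto
  with inj show ?thesis by (simp add: bij_betw_def)
qed

section \<open>Lexicographic numbering of the subsets of a given size\<close>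

lemma finite_nsets_atLeastAtMost: "finite (nsets {1..F::nat} a)"
  by (simp add: finite_imp_finite_nsets)

lemma card_nsets_atLeastAtMost: "card (nsets {1..F::nat} a) = F choose a"
proof -
  have "nsets {1..F} a = {N. N \<subseteq> {1..F} \<and> card N = a}"
    by (auto simp: nsets_def intro: finite_subset)
  then show ?thesis by (simp add: n_subsets)
qed

lemma lex_pos_bij: "bij_betw (lex_pos F a) (nsets {1..F} a) {1..F choose a}"
proof -
  let ?r = "\<lambda>T' T. (sorted_list_of_set T', sorted_list_of_set T) \<in> lexord (less_than :: (nat \<times> nat) set)"
  have "bij_betw (\<lambda>T. Suc (card {T' \<in> nsets {1..F} a. ?r T' T}))
      (nsets {1..F} a) {1..card (nsets {1..F} a)}"
  proof (rule bij_betw_rank)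
    show "\<not> ?r T T" for T :: "nat set" by (rule lexord_irreflexive) simp
    show "?r T U" if "?r T S" "?r S U" for T S U
      using that by (rule lexord_trans) simp
    fix S T :: "nat set"
    assume "S \<in> nsets {1..F} a" "T \<in> nsets {1..F} a" "S \<noteq> T"
    then have "sorted_list_of_set S \<noteq> sorted_list_of_set T"
      unfolding nsets_def by (metis (mono_tags, lifting) mem_Collect_eq set_sorted_list_of_set)
    then show "?r S T \<or> ?r T S"
      using total_lexord[OF total_less_than] unfolding total_on_def by (metis UNIV_I)
  qed (rule finite_nsets_atLeastAtMost)
  then show ?thesis
    by (simp add: card_nsets_atLeastAtMost lex_pos_def[abs_def])
qed

lemma lex_pos_in: "T \<in> nsets {1..F} a \<Longrightarrow> lex_pos F a T \<in> {1..F choose a}"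
  using bij_betwE[OF lex_pos_bij] by blast

lemma lex_pos_eq_iff:
  "S \<in> nsets {1..F} a \<Longrightarrow> T \<in> nsets {1..F} a \<Longrightarrow> lex_pos F a S = lex_pos F a T \<longleftrightarrow> S = T"
  using lex_pos_bij[of F a] unfolding bij_betw_def inj_on_def by blast

lemma nth_subset_lex_pos: "T \<in> nsets {1..F} a \<Longrightarrow> nth_subset F a (lex_pos F a T) = T"
  unfolding nth_subset_def by (rule the_equality) (use lex_pos_eq_iff in \<open>blast+\<close>)

lemma nth_subset_in:
  assumes "i \<in> {1..F choose a}"
  shows "nth_subset F a i \<in> nsets {1..F} a" "lex_pos F a (nth_subset F a i) = i"
proof -
  obtain T where "T \<in> nsets {1..F} a" "i = lex_pos F a T"
    using lex_pos_bij[of F a] assms unfolding bij_betw_def by blast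
  then show "nth_subset F a i \<in> nsets {1..F} a" "lex_pos F a (nth_subset F a i) = i"
    by (simp_all add: nth_subset_lex_pos)
qed

lemma insert_nsets: "T \<in> nsets A a \<Longrightarrow> d \<in> A \<Longrightarrow> d \<notin> T \<Longrightarrow> insert d T \<in> nsets A (Suc a)"
  by (auto simp: nsets_def)

section \<open>Entries of the diagonal block\<close>

lemma P1_eq_Star_iff: "P1 F \<alpha> d i = Star \<longleftrightarrow> d \<in> nth_subset F \<alpha> i"
  by (simp add: P1_def Let_def)

lemma P1_eq_Num_iff:
  "P1 F \<alpha> d i = Num t \<longleftrightarrow>
     d \<notin> nth_subset F \<alpha> i \<and> lex_pos F (Suc \<alpha>) (insert d (nth_subset F \<alpha> i)) = t"
  by (simp add: P1_def Let_def)

text \<open>An entry \<open>Num t\<close> records a splitting of the (\<alpha>+1)-set with number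
  \<open>t\<close> into one point, the row, and the remaining \<alpha>-set, the column. Two entries
  with the same integer are two splittings of one set.\<close>

lemma P1_same_Num:
  assumes "d \<in> {1..F}" "d' \<in> {1..F}" "i \<in> {1..F choose \<alpha>}" "i' \<in> {1..F choose \<alpha>}"
    and "P1 F \<alpha> d i = Num t" "P1 F \<alpha> d' i' = Num t" and ne: "(d, i) \<noteq> (d', i')"
  shows "d \<noteq> d'" "i \<noteq> i'" "P1 F \<alpha> d i' = Star" "P1 F \<alpha> d' i = Star"
proof -
  let ?T = "nth_subset F \<alpha> i" and ?T' = "nth_subset F \<alpha> i'"
  have T: "?T \<in> nsets {1..F} \<alpha>" "?T' \<in> nsets {1..F} \<alpha>"
    "lex_pos F \<alpha> ?T = i" "lex_pos F \<alpha> ?T' = i'"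
    using nth_subset_in assms by blast+
  have d: "d \<notin> ?T" "d' \<notin> ?T'"
    and "lex_pos F (Suc \<alpha>) (insert d ?T) = lex_pos F (Suc \<alpha>) (insert d' ?T')"
    using assms by (simp_all add: P1_eq_Num_iff)
  then have eq: "insert d ?T = insert d' ?T'"
    using lex_pos_eq_iff[OF insert_nsets[OF T(1) assms(1)] insert_nsets[OF T(2) assms(2)]] by simp
  show "d \<noteq> d'"
  proof
    assume "d = d'"
    with d eq have "?T = ?T'" by (metis insert_ident)
    then have "lex_pos F \<alpha> ?T = lex_pos F \<alpha> ?T'" by (rule arg_cong)
    then have "i = i'" unfolding T(3,4) .
    with ne \<open>d = d'\<close> show False by simp
  qed
  \<comment> \<open>Each row point lies in the common (\<alpha>+1)-set and differs from the point
    split off by the other entry, so it belongs to the other column's set.\<close>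
  moreover have "d \<in> insert d' ?T'" "d' \<in> insert d ?T"
    by (simp flip: eq, simp add: eq)
  ultimately have "d \<in> ?T'" "d' \<in> ?T" by auto
  then show "P1 F \<alpha> d i' = Star" "P1 F \<alpha> d' i = Star"
    unfolding P1_eq_Star_iff .
  show "i \<noteq> i'" using d(1) \<open>d \<in> ?T'\<close> by blast
qed

section \<open>Global and block-wise indices\<close>

lemma block_index_decompose:
  assumes "0 < n" "1 \<le> i" "i \<le> n" "1 \<le> k"
  shows "(block_index n k i - 1) div n = k - 1" "Suc ((block_index n k i - 1) mod n) = i"
proof -
  \<comment> \<open>Passing to predecessors turns the 1-based index into an ordinary quotient with
    remainder \<open>i'\<close> and removes truncated subtraction.\<close>
  obtain k' i' where "k = Suc k'" "i = Suc i'"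
    using assms by (metis Suc_le_D One_nat_def)
  then show "(block_index n k i - 1) div n = k - 1" "Suc ((block_index n k i - 1) mod n) = i"
    using assms by (simp_all add: block_index_def)
qed

lemma bij_betw_block_index:
  "bij_betw (\<lambda>(k, i). block_index n k i) ({1..K} \<times> {1..n}) {1..K * n}"
proof (cases "n = 0")
  case False
  have "inj_on (\<lambda>(k, i). block_index n k i) ({1..K} \<times> {1..n})"
  proof (rule inj_onI, clarify)
    fix k i k' i'
    assume *: "k \<in> {1..K}" "k' \<in> {1..K}" "i \<in> {1..n}" "i' \<in> {1..n}"
      and eq: "block_index n k i = block_index n k' i'"
    have "k - 1 = k' - 1" "i = i'"
      using block_index_decompose[of n i k] block_index_decompose[of n i' k'] * eq by auto
    with * show "k = k' \<and> i = i'" by auto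
  qed
  moreover have "(\<lambda>(k, i). block_index n k i) ` ({1..K} \<times> {1..n}) \<subseteq> {1..K * n}"
  proof clarify
    fix k i assume *: "k \<in> {1..K}" "i \<in> {1..n}"
    then have "block_index n k i \<le> (k - 1) * n + n" by (simp add: block_index_def)
    also have "\<dots> = k * n" using * by (cases k) auto
    also have "\<dots> \<le> K * n" using * by simp
    finally show "block_index n k i \<in> {1..K * n}" using * by (simp add: block_index_def)
  qed
  \<comment> \<open>Both sides have \<open>K * n\<close> elements, so injectivity and inclusion give
    surjectivity.\<close>
  ultimately show ?thesis
    unfolding bij_betw_def by (intro conjI card_subset_eq) (auto simp: card_image)
qed (simp add: bij_betw_def)

lemma block_index_cases:
  assumes "x \<in> {1..K * n}"
  obtains k i where "k \<in> {1..K}" "i \<in> {1..n}" "x = block_index n k i"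
proof -
  have "x \<in> (\<lambda>(k, i). block_index n k i) ` ({1..K} \<times> {1..n})"
    using bij_betw_block_index[of n K] assms by (simp add: bij_betw_def)
  then obtain z where z: "x = (case z of (k, i) \<Rightarrow> block_index n k i)" "z \<in> {1..K} \<times> {1..n}"
    by (rule imageE)
  obtain k i where ki: "z = (k, i)" by (cases z)
  show thesis by (rule that[of k i]) (use z in \<open>simp_all add: ki\<close>)
qed

lemma block_index_eq_iff:
  assumes "1 \<le> k" "1 \<le> i" "i \<le> n" "1 \<le> k'" "1 \<le> i'" "i' \<le> n"
  shows "block_index n k i = block_index n k' i' \<longleftrightarrow> k = k' \<and> i = i'"
proof
  assume eq: "block_index n k i = block_index n k' i'"
  have "0 < n" using assms by simp
  then have "k - 1 = k' - 1" "i = i'"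
    using block_index_decompose[of n i k] block_index_decompose[of n i' k'] assms eq by metis+
  with assms show "k = k' \<and> i = i'" by simp
qed simp

lemma P_array_block_index:
  assumes "1 \<le> k" "1 \<le> i" "i \<le> F choose \<alpha>" "1 \<le> j" "1 \<le> f" "f \<le> F"
  shows "P_array F \<alpha> (block_index F j f) (block_index (F choose \<alpha>) k i) =
    (if j = k then P1 F \<alpha> f i else Star)"
proof -
  have pos: "0 < F" "0 < F choose \<alpha>" using assms by linarith+
  have "j - 1 = k - 1 \<longleftrightarrow> j = k" using assms by linarith
  then show ?thesis
    unfolding P_array_def
    using assms by (simp only: block_index_decompose[OF pos(1) assms(5,6,4)]
        block_index_decompose[OF pos(2) assms(2,3,1)])
qed

section \<open>\<open>P\<close> is a placement delivery array corresponding to the model\<close>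

lemma P_array_is_pda:
  assumes "0 < K"
  shows "is_pda (K * (F choose \<alpha>)) (K * F) ((K - 1) * F + \<alpha>) (F choose Suc \<alpha>) (P_array F \<alpha>)"
proof -
  let ?Q = "F choose \<alpha>" and ?S = "F choose Suc \<alpha>" and ?A = "P_array F \<alpha>"
  have entry: "?A x c \<in> insert Star (Num ` {1..?S})"
    if x: "x \<in> {1..K * F}" and c: "c \<in> {1..K * ?Q}" for x c
  proof -
    obtain j f where j: "j \<in> {1..K}" "f \<in> {1..F}" "x = block_index F j f"
      using block_index_cases[OF x] .
    obtain k i where k: "k \<in> {1..K}" "i \<in> {1..?Q}" "c = block_index ?Q k i"
      using block_index_cases[OF c] .
    have "P1 F \<alpha> f i \<in> insert Star (Num ` {1..?S})"
      using lex_pos_in[OF insert_nsets[OF nth_subset_in(1)[OF k(2)] j(2)]]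
      by (auto simp: P1_def Let_def)
    then show ?thesis
      using j k by (simp add: P_array_block_index)
  qed
  have stars: "card {x \<in> {1..K * F}. ?A x c = Star} = (K - 1) * F + \<alpha>"
    if c: "c \<in> {1..K * ?Q}" for c
  proof -
    obtain k i where k: "k \<in> {1..K}" "i \<in> {1..?Q}" "c = block_index ?Q k i"
      using block_index_cases[OF c] .
    let ?T = "nth_subset F \<alpha> i"
    have T: "?T \<subseteq> {1..F}" "card ?T = \<alpha>" "finite ?T"
      using nth_subset_in(1)[OF k(2)] by (auto simp: nsets_def)
    \<comment> \<open>The star positions of the column: all rows of the other blocks, and in block
      \<open>k\<close> the rows of \<open>?T\<close>. The two pieces are disjoint and account for
      the two summands of the count.\<close>
    let ?B = "(({1..K} - {k}) \<times> {1..F}) \<union> ({k} \<times> ?T)"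
    have B: "?B \<subseteq> {1..K} \<times> {1..F}" using T k by auto
    have "{x \<in> {1..K * F}. ?A x c = Star} = (\<lambda>(j, f). block_index F j f) ` ?B"
    proof (intro equalityI subsetI)
      fix x assume "x \<in> {x \<in> {1..K * F}. ?A x c = Star}"
      then have x: "x \<in> {1..K * F}" "?A x c = Star" by auto
      obtain j f where j: "j \<in> {1..K}" "f \<in> {1..F}" "x = block_index F j f"
        using block_index_cases[OF x(1)] .
      have "(j, f) \<in> ?B"
        using x(2) j k by (auto simp: P_array_block_index P1_eq_Star_iff split: if_splits)
      with j show "x \<in> (\<lambda>(j, f). block_index F j f) ` ?B" by force
    next
      fix x assume "x \<in> (\<lambda>(j, f). block_index F j f) ` ?B"
      then obtain z where z: "x = (case z of (j, f) \<Rightarrow> block_index F j f)" "z \<in> ?B"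
        by (rule imageE)
      obtain j f where "z = (j, f)" by (cases z)
      with z have jf: "(j, f) \<in> ?B" "x = block_index F j f" by simp_all
      then have j: "j \<in> {1..K}" "f \<in> {1..F}" using B by auto
      have "x \<in> {1..K * F}"
        using bij_betwE[OF bij_betw_block_index[of F K]] j jf by auto
      then show "x \<in> {x \<in> {1..K * F}. ?A x c = Star}"
        using jf j k by (auto simp: P_array_block_index P1_eq_Star_iff)
    qed
    also have "card \<dots> = card ?B"
      by (intro card_image inj_on_subset[OF bij_betw_imp_inj_on[OF bij_betw_block_index] B])
    also have "\<dots> = (K - 1) * F + \<alpha>"
      using T k by (subst card_Un_disjoint) (auto simp: card_cartesian_product)
    finally show ?thesis .
  qed
  \<comment> \<open>Removing any point \<open>d\<close> from the (\<alpha>+1)-set with number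
    \<open>s\<close> leaves a column in which row \<open>d\<close> carries \<open>s\<close>. The
    first diagonal block provides the occurrence.\<close>
  have occ: "\<exists>f\<in>{1..K * F}. \<exists>k\<in>{1..K * ?Q}. ?A f k = Num s" if s: "s \<in> {1..?S}" for s
  proof -
    let ?Y = "nth_subset F (Suc \<alpha>) s"
    have Y: "?Y \<in> nsets {1..F} (Suc \<alpha>)" "lex_pos F (Suc \<alpha>) ?Y = s"
      using nth_subset_in[OF s] .
    then obtain d where d: "d \<in> ?Y" by (cases "?Y = {}") (auto simp: nsets_def)
    then have T: "?Y - {d} \<in> nsets {1..F} \<alpha>" and dF: "d \<in> {1..F}"
      using Y(1) by (auto simp: nsets_def)
    let ?i = "lex_pos F \<alpha> (?Y - {d})"
    have i: "?i \<in> {1..?Q}" using lex_pos_in[OF T] .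
    have "P1 F \<alpha> d ?i = Num s"
      using d Y by (simp add: P1_eq_Num_iff nth_subset_lex_pos[OF T] insert_absorb)
    then have "?A (block_index F 1 d) (block_index ?Q 1 ?i) = Num s"
      using assms i dF by (subst P_array_block_index) auto
    moreover have "block_index F 1 d \<in> {1..K * F}" "block_index ?Q 1 ?i \<in> {1..K * ?Q}"
      using bij_betwE[OF bij_betw_block_index[of F K]] bij_betwE[OF bij_betw_block_index[of ?Q K]]
        assms i dF by auto
    ultimately show ?thesis by blast
  qed
  have sep: "x \<noteq> y \<and> c \<noteq> e \<and> ?A x e = Star \<and> ?A y c = Star"
    if x: "x \<in> {1..K * F}" and y: "y \<in> {1..K * F}"
      and c: "c \<in> {1..K * ?Q}" and e: "e \<in> {1..K * ?Q}"
      and ne: "(x, c) \<noteq> (y, e)" and eq: "?A x c = Num s" "?A y e = Num s" for x y c e s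
  proof -
    obtain j f where j: "j \<in> {1..K}" "f \<in> {1..F}" "x = block_index F j f"
      using block_index_cases[OF x] .
    obtain j' f' where j': "j' \<in> {1..K}" "f' \<in> {1..F}" "y = block_index F j' f'"
      using block_index_cases[OF y] .
    obtain k i where k: "k \<in> {1..K}" "i \<in> {1..?Q}" "c = block_index ?Q k i"
      using block_index_cases[OF c] .
    obtain k' i' where k': "k' \<in> {1..K}" "i' \<in> {1..?Q}" "e = block_index ?Q k' i'"
      using block_index_cases[OF e] .
    have P: "j = k" "P1 F \<alpha> f i = Num s" "j' = k'" "P1 F \<alpha> f' i' = Num s"
      using eq j j' k k' by (auto simp: P_array_block_index split: if_splits)
    show ?thesis
    \<comment> \<open>Integers occur only in diagonal blocks. If the two blocks differ, the crossing
      positions are off the diagonal, hence stars; within one block the property is that of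
      \<open>P1\<close>.\<close>
    proof (cases "j = j'")
      case False
      then show ?thesis
        using P j j' k k'
        by (simp add: P_array_block_index block_index_eq_iff)
    next
      case True
      then have "(f, i) \<noteq> (f', i')" using ne P j j' k k' by auto
      then show ?thesis
        using P True j j' k k' P1_same_Num[of f F f' i \<alpha> i' s]
        by (simp add: P_array_block_index block_index_eq_iff)
    qed
  qed
  show ?thesis
    unfolding is_pda_def
  proof (intro conjI ballI allI impI)
    fix x y c e s
    assume *: "x \<in> {1..K * F}" "y \<in> {1..K * F}" "c \<in> {1..K * ?Q}" "e \<in> {1..K * ?Q}"
      "(x, c) \<noteq> (y, e) \<and> ?A x c = Num s \<and> ?A y e = Num s"
    show "x \<noteq> y" "c \<noteq> e" "?A x e = Star" "?A y c = Star"
      using sep[OF *(1-4), of s] *(5) by blast+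
  qed (fact entry stars occ)+
qed

lemma P_array_corresponds:
  assumes "n_funcs m = F choose \<alpha>"
  shows "corresponds K F \<alpha> m (P_array F \<alpha>)"
  unfolding corresponds_def assms
proof (intro conjI ballI bij_betw_block_index lex_pos_bij)
  fix k T j f
  assume *: "k \<in> {1..K}" "T \<in> nsets {1..F} \<alpha>" "j \<in> {1..K}" "f \<in> {1..F}"
  then show "P_array F \<alpha> (block_index F j f) (block_index (F choose \<alpha>) k (lex_pos F \<alpha> T)) = Star \<longleftrightarrow>
      (j, f) \<in> accessible K F k T"
    using lex_pos_in[OF *(2)]
    by (simp add: P_array_block_index P1_eq_Star_iff nth_subset_lex_pos accessible_def)
qed

section \<open>Exclusive or and chunks of lists\<close>

lemma map2_neq_involution:
  fixes xs zs :: "bool list"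
  assumes "length xs = length zs"
  shows "map2 (\<noteq>) (map2 (\<noteq>) xs zs) zs = xs" "map2 (\<noteq>) zs (map2 (\<noteq>) zs xs) = xs"
  using assms by (induction xs zs rule: list_induct2) auto

lemma map2_neq_cancel:
  fixes xs ys zs :: "bool list"
  assumes len: "length xs = length zs" "length ys = length zs"
  shows "map2 (\<noteq>) xs zs = map2 (\<noteq>) ys zs \<Longrightarrow> xs = ys"
    and "map2 (\<noteq>) zs xs = map2 (\<noteq>) zs ys \<Longrightarrow> xs = ys"
proof -
  assume "map2 (\<noteq>) xs zs = map2 (\<noteq>) ys zs"
  then have "map2 (\<noteq>) (map2 (\<noteq>) xs zs) zs = map2 (\<noteq>) (map2 (\<noteq>) ys zs) zs"
    by (rule arg_cong)
  then show "xs = ys" unfolding map2_neq_involution(1)[OF len(1)] map2_neq_involution(1)[OF len(2)] .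
next
  assume "map2 (\<noteq>) zs xs = map2 (\<noteq>) zs ys"
  then have "map2 (\<noteq>) zs (map2 (\<noteq>) zs xs) = map2 (\<noteq>) zs (map2 (\<noteq>) zs ys)"
    by (rule arg_cong)
  then show "xs = ys" unfolding map2_neq_involution(2)[OF len(1)] map2_neq_involution(2)[OF len(2)] .
qed

lemma xor_all_Cons: "xor_all n (bs # bss) = map2 (\<noteq>) bs (xor_all n bss)"
  by (simp add: xor_all_def)

lemma length_xor_all:
  assumes "\<And>bs. bs \<in> set bss \<Longrightarrow> length bs = n"
  shows "length (xor_all n bss) = n"
  using assms by (induction bss) (simp_all add: xor_all_def)

text \<open>Decoding in abstract form: an XOR equation is solved for its only unknown summand by
  cancelling the others one at a time. The length conditions matter because \<open>map2\<close>
  truncates to the shorter list, and distinctness ensures that the unknown occurs once.\<close>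

lemma xor_all_cancel:
  assumes "distinct xs" "x \<in> set xs"
    and len: "\<And>y. y \<in> set xs \<Longrightarrow> length (g y) = n" "\<And>y. y \<in> set xs \<Longrightarrow> length (g' y) = n"
    and same: "\<And>y. y \<in> set xs \<Longrightarrow> y \<noteq> x \<Longrightarrow> g y = g' y"
    and eq: "xor_all n (map g xs) = xor_all n (map g' xs)"
  shows "g x = g' x"
  using assms
proof (induction xs)
  case (Cons a xs)
  have l: "length (g a) = n" "length (g' a) = n"
    "length (xor_all n (map g xs)) = n" "length (xor_all n (map g' xs)) = n"
    using Cons.prems(3,4) by (auto intro!: length_xor_all)
  have e: "map2 (\<noteq>) (g a) (xor_all n (map g xs)) = map2 (\<noteq>) (g' a) (xor_all n (map g' xs))"
    using Cons.prems(6) by (simp only: list.map xor_all_Cons)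
  show ?case
  proof (cases "a = x")
    case True
    then have eq: "map g xs = map g' xs"
      using Cons.prems(1,5) by auto
    have "map2 (\<noteq>) (g a) (xor_all n (map g' xs)) = map2 (\<noteq>) (g' a) (xor_all n (map g' xs))"
      using e unfolding eq .
    then have "g a = g' a"
      by (rule map2_neq_cancel(1)[rotated 2]) (simp_all only: l)
    then show ?thesis unfolding True .
  next
    case False
    then have eq: "g a = g' a" by (intro Cons.prems(5)) simp_all
    have "map2 (\<noteq>) (g' a) (xor_all n (map g xs)) = map2 (\<noteq>) (g' a) (xor_all n (map g' xs))"
      using e unfolding eq .
    then have "xor_all n (map g xs) = xor_all n (map g' xs)"
      by (rule map2_neq_cancel(2)[rotated 2]) (simp_all only: l)
    then show ?thesis
      using Cons.prems(1,2) False by (intro Cons.IH Cons.prems(3-5)) simp_all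
  qed
qed simp

lemma comprehension2_eq_map_filter_product:
  "[g x y. x \<leftarrow> xs, y \<leftarrow> ys, P x y] =
     map (\<lambda>(x, y). g x y) (filter (\<lambda>(x, y). P x y) (List.product xs ys))"
proof -
  have "[g x y. y \<leftarrow> ys, P x y] =
      map (\<lambda>(x, y). g x y) (filter (\<lambda>(x, y). P x y) (map (Pair x) ys))" for x
    by (induction ys) auto
  then show ?thesis
    by (induction xs) simp_all
qed

text \<open>Separates the index triples from the values computed from them, so that distinctness and
  membership can be stated for the triples alone.\<close>

lemma comprehension3_eq_map_filter_product:
  "[g x y z. x \<leftarrow> xs, A x, y \<leftarrow> ys, z \<leftarrow> zs, P y z] =
     map (\<lambda>(x, y, z). g x y z)
       (filter (\<lambda>(x, y, z). A x \<and> P y z) (List.product xs (List.product ys zs)))"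
proof -
  have "(if A x then [g x y z. y \<leftarrow> ys, z \<leftarrow> zs, P y z] else []) =
      map (\<lambda>(x, y, z). g x y z) (filter (\<lambda>(x, y, z). A x \<and> P y z)
        (map (Pair x) (List.product ys zs)))" for x
    unfolding comprehension2_eq_map_filter_product
    by (cases "A x") (simp_all add: filter_map comp_def split_def)
  then show ?thesis
    by (induction xs) simp_all
qed

text \<open>Position \<open>b\<close> lies in chunk \<open>b div n\<close> at offset
  \<open>b mod n\<close>; that a position exists at all forces \<open>n\<close> to be
  positive.\<close>

lemma chunks_eqI:
  assumes "length xs = c * n" "length ys = c * n"
    and chunks: "\<And>i. i < c \<Longrightarrow> take n (drop (i * n) xs) = take n (drop (i * n) ys)"
  shows "xs = ys"
proof (rule nth_equalityI)
  fix b assume "b < length xs"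
  then have b: "b < c * n" using assms by simp
  then have n: "0 < n" by (cases n) auto
  have i: "b div n < c" using b by (simp add: less_mult_imp_div_less)
  have "(b div n) * n + b mod n = b" by simp
  moreover have "b mod n < n" using n by simp
  ultimately have nth: "zs ! b = take n (drop (b div n * n) zs) ! (b mod n)"
    if "length zs = c * n" for zs :: "'a list"
  proof -
    have "b div n * n \<le> length zs"
      using that b div_times_less_eq_dividend[of b n] by linarith
    then show ?thesis using \<open>b mod n < n\<close> by simp
  qed
  show "xs ! b = ys ! b"
    using nth[OF assms(1)] nth[OF assms(2)] chunks[OF i] by simp
qed (simp add: assms)

section \<open>Accessible batches, permutations and product distributions\<close>

text \<open>Every batch carries its index as a tag, so the only possible element of the second set
  with tag \<open>(j, f)\<close> is the restriction of \<open>w'\<close> to that batch.\<close>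

lemma accessible_batches_eqD:
  assumes "accessible_batches K F m k T w = accessible_batches K F m k T' w'"
    and "(j, f) \<in> accessible K F k T" and "n \<in> batch m j f"
  shows "w n = w' n"
proof -
  have "((j, f), restrict w (batch m j f)) \<in> accessible_batches K F m k T w"
    unfolding accessible_batches_def using assms(2) by force
  then have "((j, f), restrict w (batch m j f)) \<in> accessible_batches K F m k T' w'"
    using assms(1) by simp
  then have "restrict w (batch m j f) = restrict w' (batch m j f)"
    unfolding accessible_batches_def by auto
  then show ?thesis
    using assms(3) by (metis restrict_apply')
qed

lemma accessible_batches_conn:
  assumes "k \<in> {1..K}" "T \<subseteq> {1..F}"
  shows "{f. (k, f) \<in> fst ` accessible_batches K F m k T w} = T"
proof -
  have "fst ` accessible_batches K F m k T w = accessible K F k T"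
    unfolding accessible_batches_def by (force simp: image_image)
  then show ?thesis using assms by (auto simp: accessible_def)
qed

lemma permutes_fixing_point_nonempty:
  assumes "a \<in> A" "d \<in> A"
  shows "{\<pi>. \<pi> permutes A \<and> \<pi> a = d} \<noteq> {}"
proof -
  have "Transposition.transpose a d permutes A" using assms by (intro permutes_swap_id)
  then show ?thesis by (auto intro!: exI[of _ "Transposition.transpose a d"])
qed

text \<open>Composing with the transposition of \<open>a\<close> and \<open>b\<close> is its own
  inverse and exchanges the two conditions. Equal sizes will make a mixture over the positions
  uniform.\<close>

lemma card_permutes_fixing_point:
  assumes "a \<in> A" "b \<in> A"
  shows "card {\<pi>. \<pi> permutes A \<and> \<pi> a = d} = card {\<pi>. \<pi> permutes A \<and> \<pi> b = d}"
proof (rule bij_betw_same_card)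
  let ?t = "Transposition.transpose a b"
  have t: "?t permutes A" using assms by (intro permutes_swap_id)
  show "bij_betw (\<lambda>\<pi>. \<pi> \<circ> ?t) {\<pi>. \<pi> permutes A \<and> \<pi> a = d} {\<pi>. \<pi> permutes A \<and> \<pi> b = d}"
    by (rule bij_betwI[where g = "\<lambda>\<pi>. \<pi> \<circ> ?t"])
      (auto simp: permutes_compose[OF t] comp_assoc)
qed

text \<open>The law from the viewpoint of \<open>R_k\<close>: its own connection and query are
  singled out, and since \<open>h\<close> sees only \<open>T k\<close> among the connections, the
  others are averaged out, leaving independent queries with laws \<open>V j\<close>.\<close>

lemma Pi_pmf_bind_split:
  assumes "finite A" "k \<in> A"
    and V: "\<And>j. j \<in> A - {k} \<Longrightarrow> bind_pmf (U j) (\<kappa> j) = V j"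
  shows "do {T \<leftarrow> Pi_pmf A u U; y \<leftarrow> Pi_pmf A v (\<lambda>j. \<kappa> j (T j)); h (T k) y} =
    do {t \<leftarrow> U k; x \<leftarrow> \<kappa> k t; y \<leftarrow> Pi_pmf (A - {k}) v V; h t (y(k := x))}"
proof -
  let ?A = "A - {k}"
  have A: "A = insert k ?A" "finite ?A" "k \<notin> ?A" using assms by auto
  have y: "Pi_pmf A v (\<lambda>j. \<kappa> j ((T(k := t)) j)) =
      do {x \<leftarrow> \<kappa> k t; y \<leftarrow> Pi_pmf ?A v (\<lambda>j. \<kappa> j (T j)); return_pmf (y(k := x))}" for T t
  proof -
    have "Pi_pmf ?A v (\<lambda>j. \<kappa> j ((T(k := t)) j)) = Pi_pmf ?A v (\<lambda>j. \<kappa> j (T j))"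
      by (rule Pi_pmf_cong) auto
    then show ?thesis
      using Pi_pmf_insert'[OF A(2,3), of v "\<lambda>j. \<kappa> j ((T(k := t)) j)"] A(1) by simp
  qed
  have T: "Pi_pmf A u U = do {t \<leftarrow> U k; T \<leftarrow> Pi_pmf ?A u U; return_pmf (T(k := t))}"
    using Pi_pmf_insert'[OF A(2,3), of u U] A(1) by simp
  \<comment> \<open>A product of mixtures is the mixture of the products, by
    \<open>Pi_pmf_bind\<close>.\<close>
  have V': "do {T \<leftarrow> Pi_pmf ?A u U; Pi_pmf ?A v (\<lambda>j. \<kappa> j (T j))} = Pi_pmf ?A v V"
  proof -
    have "Pi_pmf ?A v (\<lambda>j. bind_pmf (U j) (\<kappa> j)) = Pi_pmf ?A v V"
      using V by (intro Pi_pmf_cong) auto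
    then show ?thesis by (simp add: Pi_pmf_bind[OF A(2), of v U \<kappa> u])
  qed
  have "do {T \<leftarrow> Pi_pmf A u U; y \<leftarrow> Pi_pmf A v (\<lambda>j. \<kappa> j (T j)); h (T k) y} =
    do {t \<leftarrow> U k; T \<leftarrow> Pi_pmf ?A u U; x \<leftarrow> \<kappa> k t;
        y \<leftarrow> Pi_pmf ?A v (\<lambda>j. \<kappa> j (T j)); h t (y(k := x))}"
    unfolding T bind_assoc_pmf bind_return_pmf y by simp
  \<comment> \<open>The own query \<open>x\<close> depends only on \<open>t\<close>, so it may be
    drawn before the other connections.\<close>
  also have "\<dots> = do {t \<leftarrow> U k; x \<leftarrow> \<kappa> k t;
      y \<leftarrow> do {T \<leftarrow> Pi_pmf ?A u U; Pi_pmf ?A v (\<lambda>j. \<kappa> j (T j))}; h t (y(k := x))}"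
    by (subst bind_commute_pmf) (simp add: bind_assoc_pmf)
  finally show ?thesis unfolding V' .
qed

section \<open>The coding scheme\<close>

context
  fixes K F \<alpha> :: nat
    and m :: "('w::{field,finite}, 'v::{field,finite}, 'o::{field,finite}) madc"
    and p :: "((nat \<Rightarrow> 'w) \<times> (nat \<Rightarrow> nat)) pmf"
  assumes K: "K > 1" and \<alpha>: "\<alpha> \<in> {1..F - 1}"
    and model: "ppma_madc K F m"
    and Q: "n_funcs m = F choose \<alpha>"
    and packets: "(K - 1) dvd n_files m div (K * F) * iv_len m"
    and supp: "set_pmf p \<subseteq> ({1..n_files m} \<rightarrow>\<^sub>E UNIV) \<times> ({1..K} \<rightarrow>\<^sub>E {1..n_funcs m})"
begin

abbreviation (input) "conns \<equiv> nsets {1..F} \<alpha>"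
abbreviation (input) "scheme_law \<equiv> joint_law K F \<alpha> m (scheme_query F \<alpha> m) p"
abbreviation (input) "plen \<equiv> packet_len K F m"

section \<open>Batches, their bit strings and packets\<close>

lemma
  shows batch_card: "k \<in> {1..K} \<Longrightarrow> f \<in> {1..F} \<Longrightarrow> card (batch m k f) = n_files m div (K * F)"
    and batch_subset: "k \<in> {1..K} \<Longrightarrow> f \<in> {1..F} \<Longrightarrow> batch m k f \<subseteq> {1..n_files m}"
    and batch_cover: "n \<in> {1..n_files m} \<Longrightarrow> \<exists>k\<in>{1..K}. \<exists>f\<in>{1..F}. n \<in> batch m k f"
    and iv_rep_bij: "bij_betw (iv_rep m) UNIV {bs. length bs = iv_len m}"
    and n_files_pos: "n_files m > 0" and n_files_dvd: "K * F dvd n_files m"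
  using model unfolding ppma_madc_def by blast+

lemma batch_finite: "k \<in> {1..K} \<Longrightarrow> f \<in> {1..F} \<Longrightarrow> finite (batch m k f)"
  using batch_subset by (meson finite_atLeastAtMost finite_subset)

text \<open>A field has two distinct elements 0 and 1, so intermediate values have at least one bit.
  This is needed to cancel \<beta> in the communication load.\<close>

lemma iv_len_pos: "iv_len m > 0"
proof (rule ccontr)
  assume "\<not> iv_len m > 0"
  then have "CARD('v) = 1" using model by (simp add: ppma_madc_def)
  then have "(0 :: 'v) = 1" by (metis card_1_singletonE UNIV_I singletonD)
  then show False by simp
qed

lemma length_iv_rep: "length (iv_rep m v) = iv_len m"
  using iv_rep_bij by (auto simp: bij_betw_def)

lemma iv_rep_eq_iff: "iv_rep m u = iv_rep m v \<longleftrightarrow> u = v"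
  using iv_rep_bij by (auto simp: bij_betw_def inj_on_def)

lemma packet_len_eq: "(K - 1) * plen = n_files m div (K * F) * iv_len m"
  unfolding packet_len_def using packets by simp

lemma length_batch_string:
  assumes "k \<in> {1..K}" "f \<in> {1..F}"
  shows "length (batch_string m w q k f) = (K - 1) * plen"
proof -
  have "length (batch_string m w q k f) = card (batch m k f) * iv_len m"
    unfolding batch_string_def
    by (simp add: length_concat comp_def length_iv_rep sum_list_triv)
  then show ?thesis unfolding packet_len_eq using assms by (simp add: batch_card)
qed

text \<open>The labels before \<open>l\<close> avoid both \<open>k\<close> and \<open>l\<close>, so
  at most \<open>K - 2\<close> packets precede this one and the string is long enough for a full
  packet.\<close>

lemma length_packet:
  assumes "k \<in> {1..K}" "f \<in> {1..F}" "l \<in> {1..K} - {k}"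
  shows "length (packet K F m w l q k f) = plen"
proof -
  let ?c = "card {l' \<in> {1..K} - {k}. l' < l}"
  have "?c \<le> card ({1..K} - {k, l})" by (intro card_mono) auto
  also have "\<dots> = K - 2" using assms by (simp add: card_Diff_subset)
  finally have "Suc ?c \<le> K - 1" using K by simp
  then have "Suc ?c * plen \<le> (K - 1) * plen" by (rule mult_right_mono) simp
  then show ?thesis
    using assms by (simp add: packet_def length_batch_string)
qed

lemma packet_cong:
  assumes "k \<in> {1..K}" "f \<in> {1..F}" and "\<And>n. n \<in> batch m k f \<Longrightarrow> w n = w' n"
  shows "packet K F m w l q k f = packet K F m w' l q k f"
proof -
  have "batch_string m w q k f = batch_string m w' q k f"
    unfolding batch_string_def using assms batch_finite
    by (intro arg_cong[where f = concat] map_cong) (simp_all add: iv_def)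
  then show ?thesis by (simp add: packet_def)
qed

text \<open>The packets with all labels cover the batch string. It splits uniquely into intermediate
  values because these have equal length, and \<open>iv_rep\<close> is injective.\<close>

lemma iv_eq_if_packets_eq:
  assumes k: "k \<in> {1..K}" and f: "f \<in> {1..F}" and n: "n \<in> batch m k f"
    and eq: "\<And>l. l \<in> {1..K} - {k} \<Longrightarrow> packet K F m w l q k f = packet K F m w' l q k f"
  shows "iv m w q n = iv m w' q n"
proof -
  let ?L = "{1..K} - {k}"
  have "batch_string m w q k f = batch_string m w' q k f"
  proof (rule chunks_eqI)
    fix i assume i: "i < K - 1"
    \<comment> \<open>Packet offsets count from 0 and ranks from 1: the chunk at offset
      \<open>i\<close> has the label of rank \<open>Suc i\<close>.\<close>
    have "bij_betw (\<lambda>l. Suc (card {l' \<in> ?L. l' < l})) ?L {1..card ?L}"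
      by (rule bij_betw_rank) auto
    moreover have "Suc i \<in> {1..card ?L}" using i k by simp
    ultimately obtain l where "l \<in> ?L" "Suc i = Suc (card {l' \<in> ?L. l' < l})"
      unfolding bij_betw_def by blast
    then show "take plen (drop (i * plen) (batch_string m w q k f)) =
        take plen (drop (i * plen) (batch_string m w' q k f))"
      using eq[of l] by (simp add: packet_def)
  qed (use length_batch_string k f in simp_all)
  then have "map (\<lambda>n. iv_rep m (iv m w q n)) (sorted_list_of_set (batch m k f)) =
      map (\<lambda>n. iv_rep m (iv m w' q n)) (sorted_list_of_set (batch m k f))"
    unfolding batch_string_def
    by (subst (asm) concat_eq_concat_iff) (auto simp: length_iv_rep zip_map_map)
  then show ?thesis
    using n batch_finite[OF k f] by (simp add: iv_rep_eq_iff)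
qed

section \<open>Messages as XORs over lists of index triples\<close>

definition msg_index :: "nat \<Rightarrow> nat \<Rightarrow> (nat \<times> nat \<times> nat) list" where
  "msg_index k t = filter (\<lambda>(j, f, i). j \<noteq> k \<and> P1 F \<alpha> f i = Num t)
     (List.product [1..<Suc K] (List.product [1..<Suc F] [1..<Suc (n_funcs m)]))"

lemma distinct_msg_index: "distinct (msg_index k t)"
  unfolding msg_index_def by (intro distinct_filter distinct_product) simp_all

lemma set_msg_index:
  "(j, f, i) \<in> set (msg_index k t) \<longleftrightarrow>
     j \<in> {1..K} - {k} \<and> f \<in> {1..F} \<and> i \<in> {1..F choose \<alpha>} \<and> P1 F \<alpha> f i = Num t"
  unfolding msg_index_def by (auto simp: Q)

text \<open>The list \<open>msg_index k t\<close> involves neither files nor queries, so the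
  messages of two outcomes are XORs over the same list and can be compared summand by
  summand.\<close>

lemma scheme_message_eq:
  "scheme_message K F \<alpha> m k \<omega> =
     map (\<lambda>t. xor_all plen
       (map (\<lambda>(j, f, i). packet K F m (files \<omega>) k (query \<omega> j i) j f) (msg_index k t)))
       [1..<Suc (F choose Suc \<alpha>)]"
  unfolding scheme_message_def msg_index_def comprehension3_eq_map_filter_product by simp

lemma scheme_message_component_eq:
  assumes "scheme_message K F \<alpha> m l \<omega> = scheme_message K F \<alpha> m l \<omega>'" "t \<in> {1..F choose Suc \<alpha>}"
  shows "xor_all plen (map (\<lambda>(j, f, i). packet K F m (files \<omega>) l (query \<omega> j i) j f) (msg_index l t)) =
    xor_all plen (map (\<lambda>(j, f, i). packet K F m (files \<omega>') l (query \<omega>' j i) j f) (msg_index l t))"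
proof -
  have "t \<in> set [1..<Suc (F choose Suc \<alpha>)]"
    using assms(2) by (simp add: less_Suc_eq_le del: upt_Suc)
  then show ?thesis using assms(1) unfolding scheme_message_eq map_eq_conv by blast
qed

lemma length_scheme_message:
  assumes "k \<in> {1..K}"
  shows "length (concat (scheme_message K F \<alpha> m k \<omega>)) = (F choose Suc \<alpha>) * plen"
proof -
  have "length (xor_all plen (map (\<lambda>(j, f, i). packet K F m (files \<omega>) k (query \<omega> j i) j f)
      (msg_index k t))) = plen" for t
    using assms by (intro length_xor_all) (auto simp: set_msg_index length_packet)
  then show ?thesis
    unfolding scheme_message_eq by (simp add: length_concat comp_def sum_list_triv del: upt_Suc)
qed

section \<open>The law of the queries\<close>

lemma scheme_query_accessible:
  assumes "k \<in> {1..K}" "T \<in> conns"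
  shows "scheme_query F \<alpha> m k d (accessible_batches K F m k T w) =
    pmf_of_set {\<pi>. \<pi> permutes {1..n_funcs m} \<and> \<pi> (lex_pos F \<alpha> T) = d}"
proof -
  have "T \<subseteq> {1..F}" using assms(2) by (simp add: nsets_def)
  then show ?thesis
    using assms(1) by (simp add: scheme_query_def accessible_batches_conn)
qed

lemma conns_nonempty: "conns \<noteq> {}"
  unfolding nsets_eq_empty_iff using \<alpha> by auto

lemma set_scheme_query:
  assumes "k \<in> {1..K}" "T \<in> conns" "d \<in> {1..n_funcs m}"
  shows "set_pmf (scheme_query F \<alpha> m k d (accessible_batches K F m k T w)) =
    {\<pi>. \<pi> permutes {1..n_funcs m} \<and> \<pi> (lex_pos F \<alpha> T) = d}"
proof -
  have "finite {\<pi>. \<pi> permutes {1..n_funcs m} \<and> \<pi> (lex_pos F \<alpha> T) = d}"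
    by (rule finite_subset[OF _ finite_permutations[of "{1..n_funcs m}"]]) auto
  \<comment> \<open>A uniform distribution makes sense only on a nonempty set; that the demand lies
    in \<open>{1..n_funcs m}\<close> guarantees a suitable permutation.\<close>
  moreover have "{\<pi>. \<pi> permutes {1..n_funcs m} \<and> \<pi> (lex_pos F \<alpha> T) = d} \<noteq> {}"
    using lex_pos_in[OF assms(2)] assms(3) by (intro permutes_fixing_point_nonempty) (simp_all add: Q)
  ultimately show ?thesis
    unfolding scheme_query_accessible[OF assms(1,2)] by (intro set_pmf_of_set)
qed

text \<open>The core of privacy. A permutation takes the value \<open>d\<close> at exactly one
  position, so the sets of admissible queries, over all connections \<open>T\<close>, partition the
  permutations; they have equal sizes, hence the mixture is uniform and free of \<open>d\<close> and
  \<open>w\<close>.\<close>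

lemma scheme_query_uniform:
  assumes "k \<in> {1..K}" "d \<in> {1..n_funcs m}"
  shows "bind_pmf (pmf_of_set conns)
      (\<lambda>T. scheme_query F \<alpha> m k d (accessible_batches K F m k T w)) =
    pmf_of_set {\<pi>. \<pi> permutes {1..n_funcs m}}"
proof -
  let ?f = "\<lambda>T. {\<pi>. \<pi> permutes {1..n_funcs m} \<and> \<pi> (lex_pos F \<alpha> T) = d}"
  have lex: "lex_pos F \<alpha> T \<in> {1..n_funcs m}" if "T \<in> conns" for T
    using lex_pos_in[OF that] by (simp add: Q)
  obtain T\<^sub>0 where T\<^sub>0: "T\<^sub>0 \<in> conns" using conns_nonempty by blast
  have UN: "(\<Union>(?f ` conns)) = {\<pi>. \<pi> permutes {1..n_funcs m}}"
  proof (intro equalityI subsetI)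
    fix \<pi> assume "\<pi> \<in> {\<pi>. \<pi> permutes {1..n_funcs m}}"
    then have \<pi>: "\<pi> permutes {1..n_funcs m}" by simp
    then have "d \<in> \<pi> ` {1..n_funcs m}" using assms(2) by (simp add: permutes_image)
    then obtain a where a: "a \<in> {1..F choose \<alpha>}" and "\<pi> a = d" unfolding Q by blast
    then have "nth_subset F \<alpha> a \<in> conns" "\<pi> (lex_pos F \<alpha> (nth_subset F \<alpha> a)) = d"
      using nth_subset_in[OF a] by simp_all
    with \<pi> show "\<pi> \<in> (\<Union>(?f ` conns))" by blast
  qed blast
  have "pmf_of_set (\<Union>(?f ` conns)) = do {T \<leftarrow> pmf_of_set conns; pmf_of_set (?f T)}"
  proof (rule pmf_of_set_UN)
    show "finite (\<Union>(?f ` conns))" unfolding UN by (simp add: finite_permutations)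
    show "?f T \<noteq> {}" if "T \<in> conns" for T
      using lex[OF that] assms(2) by (rule permutes_fixing_point_nonempty)
    show "card (?f T) = card (?f T\<^sub>0)" if "T \<in> conns" for T
      using lex[OF that] lex[OF T\<^sub>0] by (rule card_permutes_fixing_point)
    show "disjoint_family_on ?f conns"
    proof (unfold disjoint_family_on_def, intro ballI impI)
      fix S T assume ST: "S \<in> conns" "T \<in> conns" "S \<noteq> T"
      show "?f S \<inter> ?f T = {}"
      proof (rule equals0I)
        fix \<pi> assume "\<pi> \<in> ?f S \<inter> ?f T"
        then have "\<pi> permutes {1..n_funcs m}" "\<pi> (lex_pos F \<alpha> S) = \<pi> (lex_pos F \<alpha> T)"
          by simp_all
        then have "lex_pos F \<alpha> S = lex_pos F \<alpha> T" using permutes_inj injD by metis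
        then show False using ST lex_pos_eq_iff by blast
      qed
    qed
  qed (rule conns_nonempty)
  then have "do {T \<leftarrow> pmf_of_set conns; pmf_of_set (?f T)} = pmf_of_set {\<pi>. \<pi> permutes {1..n_funcs m}}"
    unfolding UN by (rule sym)
  moreover have "do {T \<leftarrow> pmf_of_set conns; pmf_of_set (?f T)} =
      bind_pmf (pmf_of_set conns) (\<lambda>T. scheme_query F \<alpha> m k d (accessible_batches K F m k T w))"
    using assms(1) conns_nonempty finite_nsets_atLeastAtMost
    by (intro bind_pmf_cong refl) (simp add: scheme_query_accessible)
  ultimately show ?thesis by simp
qed

lemma demand_in: "(w, d) \<in> set_pmf p \<Longrightarrow> k \<in> {1..K} \<Longrightarrow> d k \<in> {1..n_funcs m}"
  using supp by (blast dest: PiE_mem)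

lemma set_pmf_conns:
  "set_pmf (Pi_pmf {1..K} undefined (\<lambda>_. pmf_of_set conns)) = PiE_dflt {1..K} undefined (\<lambda>_. conns)"
  using conns_nonempty finite_nsets_atLeastAtMost[of F \<alpha>] by (simp add: set_Pi_pmf comp_def)

lemma scheme_lawE:
  assumes "\<omega> \<in> set_pmf scheme_law" "k \<in> {1..K}"
  shows "conn \<omega> k \<in> conns" "query \<omega> k (lex_pos F \<alpha> (conn \<omega> k)) = demand \<omega> k"
proof -
  obtain w d T y where *: "(w, d) \<in> set_pmf p" "T \<in> PiE_dflt {1..K} undefined (\<lambda>_. conns)"
    "y \<in> set_pmf (Pi_pmf {1..K} undefined
      (\<lambda>k. scheme_query F \<alpha> m k (d k) (accessible_batches K F m k (T k) w)))"
    "\<omega> = \<lparr>files = w, demand = d, conn = T, query = y\<rparr>"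
    using assms(1) unfolding joint_law_def by (auto simp: set_pmf_conns[unfolded One_nat_def])
  have T: "T k \<in> conns" using *(2) assms(2) by (simp add: PiE_dflt_def)
  then show "conn \<omega> k \<in> conns" by (simp add: *(4))
  have "y k \<in> set_pmf (scheme_query F \<alpha> m k (d k) (accessible_batches K F m k (T k) w))"
    using *(3) assms(2) by (simp add: set_Pi_pmf PiE_dflt_def)
  then show "query \<omega> k (lex_pos F \<alpha> (conn \<omega> k)) = demand \<omega> k"
    using set_scheme_query[OF assms(2) T demand_in[OF *(1) assms(2)]] by (simp add: *(4))
qed

lemma finite_scheme_law: "finite (set_pmf scheme_law)"
proof -
  have p: "finite (set_pmf p)"
    by (rule finite_subset[OF supp]) (simp add: finite_PiE)
  have y: "finite (set_pmf (Pi_pmf {1..K} undefined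
      (\<lambda>k. scheme_query F \<alpha> m k (d k) (accessible_batches K F m k (T k) w))))"
    if wd: "(w, d) \<in> set_pmf p" and T: "T \<in> PiE_dflt {1..K} undefined (\<lambda>_. conns)" for w d T
  proof -
    have "finite (set_pmf (scheme_query F \<alpha> m k (d k) (accessible_batches K F m k (T k) w)))"
      if k: "k \<in> {1..K}" for k
    proof -
      have "T k \<in> conns" using T k by (simp add: PiE_dflt_def)
      then show ?thesis
        unfolding set_scheme_query[OF k \<open>T k \<in> conns\<close> demand_in[OF wd k]]
        by (intro finite_subset[OF _ finite_permutations[of "{1..n_funcs m}"]]) auto
    qed
    then show ?thesis
      unfolding set_Pi_pmf[OF finite_atLeastAtMost] comp_def by (intro finite_PiE_dflt finite_atLeastAtMost)
  qed
  have T: "finite (PiE_dflt {1..K} undefined (\<lambda>_. conns))"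
    by (intro finite_PiE_dflt finite_nsets_atLeastAtMost) simp
  show ?thesis
    unfolding joint_law_def using p T y by (auto simp: set_pmf_conns[unfolded One_nat_def])
qed

section \<open>Encoding, decoding and privacy\<close>

lemma scheme_encoding: "encoding_req K F m scheme_law (scheme_message K F \<alpha> m)"
  unfolding encoding_req_def
proof (intro ballI cond_H_eq_0 finite_scheme_law)
  fix k and \<omega> \<omega>' :: "('w, nat \<Rightarrow> nat) outcome"
  assume k: "k \<in> {1..K}" and
    "(known_batches K F m k \<omega>, \<lambda>j\<in>{1..K}. query \<omega> j) =
     (known_batches K F m k \<omega>', \<lambda>j\<in>{1..K}. query \<omega>' j)"
  then have R: "known_batches K F m k \<omega> = known_batches K F m k \<omega>'"
    and q: "(\<lambda>j\<in>{1..K}. query \<omega> j) = (\<lambda>j\<in>{1..K}. query \<omega>' j)" by blast+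
  \<comment> \<open>Only packets of blocks \<open>j\<close> other than \<open>k\<close> enter the
    message of \<open>R_k\<close>, and every batch of those blocks is accessible to it.\<close>
  have "packet K F m (files \<omega>) k (query \<omega> j i) j f = packet K F m (files \<omega>') k (query \<omega>' j i) j f"
    if "(j, f, i) \<in> set (msg_index k t)" for j f i t
  proof -
    have j: "j \<in> {1..K}" "j \<noteq> k" "f \<in> {1..F}" using that by (simp_all add: set_msg_index)
    then have "query \<omega> j = query \<omega>' j" using q by (metis restrict_apply')
    moreover have "(j, f) \<in> accessible K F k (conn \<omega> k)" using j by (simp add: accessible_def)
    ultimately show ?thesis
      using packet_cong[OF j(1,3)] accessible_batches_eqD[OF R[unfolded known_batches_def]] by metis
  qed
  then show "scheme_message K F \<alpha> m k \<omega> = scheme_message K F \<alpha> m k \<omega>'"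
    unfolding scheme_message_eq
    by (intro map_cong refl arg_cong[where f = "xor_all _"]) auto
qed

lemma scheme_decoding: "decoding_req K F m scheme_law (scheme_message K F \<alpha> m)"
  unfolding decoding_req_def
proof (intro ballI cond_H_eq_0 finite_scheme_law)
  fix k and \<omega> \<omega>' :: "('w, nat \<Rightarrow> nat) outcome"
  assume k: "k \<in> {1..K}" and \<omega>: "\<omega> \<in> set_pmf scheme_law" "\<omega>' \<in> set_pmf scheme_law" and
    "(known_batches K F m k \<omega>, demand \<omega> k, \<lambda>j\<in>{1..K}. query \<omega> j,
      \<lambda>j\<in>{1..K}. scheme_message K F \<alpha> m j \<omega>) =
     (known_batches K F m k \<omega>', demand \<omega>' k, \<lambda>j\<in>{1..K}. query \<omega>' j,
      \<lambda>j\<in>{1..K}. scheme_message K F \<alpha> m j \<omega>')"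
  then have R: "known_batches K F m k \<omega> = known_batches K F m k \<omega>'"
    and d: "demand \<omega> k = demand \<omega>' k"
    and q: "(\<lambda>j\<in>{1..K}. query \<omega> j) = (\<lambda>j\<in>{1..K}. query \<omega>' j)"
    and X: "(\<lambda>j\<in>{1..K}. scheme_message K F \<alpha> m j \<omega>) = (\<lambda>j\<in>{1..K}. scheme_message K F \<alpha> m j \<omega>')"
    by blast+
  have q: "query \<omega> j = query \<omega>' j" if "j \<in> {1..K}" for j
    using q that by (metis restrict_apply')
  have X: "scheme_message K F \<alpha> m j \<omega> = scheme_message K F \<alpha> m j \<omega>'" if "j \<in> {1..K}" for j
    using X that by (metis restrict_apply')
  define T where "T = conn \<omega> k"
  define a where "a = lex_pos F \<alpha> T"
  have T: "T \<in> conns" and qa: "query \<omega> k a = demand \<omega> k"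
    using scheme_lawE[OF \<omega>(1) k] by (simp_all add: T_def a_def)
  have a: "a \<in> {1..F choose \<alpha>}" and nth: "nth_subset F \<alpha> a = T"
    using lex_pos_in[OF T] nth_subset_lex_pos[OF T] by (simp_all add: a_def)
  have known: "files \<omega> n = files \<omega>' n"
    if "(j, f) \<in> accessible K F k T" "n \<in> batch m j f" for j f n
    using accessible_batches_eqD[OF R[unfolded known_batches_def]] that unfolding T_def by blast
  \<comment> \<open>The packet with label \<open>l\<close> of the missing batch
    \<open>(k, f)\<close> is recovered from component \<open>t\<close> of the message of
    \<open>R_l\<close>, where \<open>t\<close> is the integer in row \<open>f\<close> of column
    \<open>a\<close>.\<close>
  have missing: "packet K F m (files \<omega>) l (demand \<omega> k) k f = packet K F m (files \<omega>') l (demand \<omega> k) k f"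
    if f: "f \<in> {1..F}" "f \<notin> T" and l: "l \<in> {1..K} - {k}" for f l
  proof -
    define t where "t = lex_pos F (Suc \<alpha>) (insert f T)"
    have t: "t \<in> {1..F choose Suc \<alpha>}"
      unfolding t_def using insert_nsets[OF T f] by (rule lex_pos_in)
    have P1: "P1 F \<alpha> f a = Num t"
      unfolding P1_eq_Num_iff nth t_def using f by simp
    let ?g = "\<lambda>\<omega>. (\<lambda>(j, f, i). packet K F m (files \<omega>) l (query \<omega> j i) j f)"
    have "?g \<omega> (k, f, a) = ?g \<omega>' (k, f, a)"
    proof (rule xor_all_cancel[where xs = "msg_index l t" and n = plen])
      show "distinct (msg_index l t)" by (rule distinct_msg_index)
      show "(k, f, a) \<in> set (msg_index l t)"
        using k f l a P1 by (auto simp: set_msg_index)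
      show "xor_all plen (map (?g \<omega>) (msg_index l t)) = xor_all plen (map (?g \<omega>') (msg_index l t))"
        using X l t by (intro scheme_message_component_eq) auto
      fix y assume y: "y \<in> set (msg_index l t)"
      obtain j f' i where y_eq: "y = (j, f', i)" by (cases y)
      have y': "j \<in> {1..K}" "j \<noteq> l" "f' \<in> {1..F}" "i \<in> {1..F choose \<alpha>}" "P1 F \<alpha> f' i = Num t"
        using y unfolding y_eq by (simp_all add: set_msg_index)
      then show "length (?g \<omega> y) = plen" "length (?g \<omega>' y) = plen"
        using l by (auto simp: y_eq intro: length_packet)
      assume "y \<noteq> (k, f, a)"
      \<comment> \<open>A further summand of block \<open>k\<close> carries the same integer, so its
        row has a star in column \<open>a\<close> and its batch is accessible.\<close>
      then have "j \<noteq> k \<or> P1 F \<alpha> f' a = Star"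
        using P1_same_Num(3)[OF y'(3) f(1) y'(4) a y'(5) P1] by (auto simp: y_eq)
      then have "(j, f') \<in> accessible K F k T"
        using y' by (auto simp: accessible_def P1_eq_Star_iff nth)
      then have "packet K F m (files \<omega>) l (query \<omega> j i) j f' =
          packet K F m (files \<omega>') l (query \<omega> j i) j f'"
        using known by (intro packet_cong y'(1,3)) blast
      then show "?g \<omega> y = ?g \<omega>' y"
        by (simp add: y_eq q[OF y'(1)])
    qed
    then show ?thesis
      by (simp add: q[OF k, symmetric] qa)
  qed
  have "iv m (files \<omega>) (demand \<omega> k) n = iv m (files \<omega>') (demand \<omega> k) n"
    if n: "n \<in> {1..n_files m}" for n
  proof -
    obtain j f where j: "j \<in> {1..K}" "f \<in> {1..F}" "n \<in> batch m j f"
      using batch_cover[OF n] by blast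
    show ?thesis
    \<comment> \<open>Accessible files agree outright; an inaccessible file lies in block
      \<open>k\<close>, where all packets of its batch have been recovered.\<close>
    proof (cases "(j, f) \<in> accessible K F k T")
      case True
      then show ?thesis using known j by (simp add: iv_def)
    next
      case False
      then have "j = k" "f \<notin> T" using j by (auto simp: accessible_def)
      with j missing show ?thesis
        by (intro iv_eq_if_packets_eq) simp_all
    qed
  qed
  then show "output_fn m (files \<omega>) (demand \<omega> k) = output_fn m (files \<omega>') (demand \<omega>' k)"
    unfolding output_fn_def d[symmetric] by (intro arg_cong[where f = "reduce_fn m _"] restrict_ext)
qed

text \<open>Given the demand and batches of \<open>R_k\<close>, its own query has no further
  dependence on the demands, and every other query is a uniform permutation.\<close>

lemma scheme_privacy: "privacy_req K F m scheme_law"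
  unfolding privacy_req_def
proof (intro ballI cond_I_eq_0 finite_scheme_law)
  fix k assume k: "k \<in> {1..K}"
  let ?A = "{1..K}" and ?U = "pmf_of_set conns" and ?V = "pmf_of_set {\<pi>. \<pi> permutes {1..n_funcs m}}"
  let ?R = "\<lambda>w k T. accessible_batches K F m k T w"
  define H where "H = (\<lambda>w (d :: nat \<Rightarrow> nat) t (y :: nat \<Rightarrow> nat \<Rightarrow> nat).
    ((restrict d ?A, (d k, ?R w k t)), restrict y ?A))"
  \<comment> \<open>\<open>\<mu>\<close> is the joint law of all demands and the knowledge of
    \<open>R_k\<close>; \<open>g\<close> is the kernel producing all queries from that knowledge
    alone.\<close>
  define \<mu> where "\<mu> = do {(w, d) \<leftarrow> p; t \<leftarrow> ?U; return_pmf (restrict d ?A, (d k, ?R w k t))}"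
  define g where "g = (\<lambda>(d, R). do {x \<leftarrow> scheme_query F \<alpha> m k d R;
    y \<leftarrow> Pi_pmf (?A - {k}) undefined (\<lambda>_. ?V); return_pmf (restrict (y(k := x)) ?A)})"
  have "map_pmf (\<lambda>\<omega>. ((\<lambda>j\<in>?A. demand \<omega> j, demand \<omega> k, known_batches K F m k \<omega>),
      \<lambda>j\<in>?A. query \<omega> j)) scheme_law =
    do {(w, d) \<leftarrow> p;
        T \<leftarrow> Pi_pmf ?A undefined (\<lambda>_. ?U);
        y \<leftarrow> Pi_pmf ?A undefined (\<lambda>j. scheme_query F \<alpha> m j (d j) (?R w j (T j)));
        return_pmf (H w d (T k) y)}"
    unfolding joint_law_def H_def
    by (simp add: map_bind_pmf split_def known_batches_def)
  also have "\<dots> = do {(w, d) \<leftarrow> p; t \<leftarrow> ?U; x \<leftarrow> scheme_query F \<alpha> m k (d k) (?R w k t);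
      y \<leftarrow> Pi_pmf (?A - {k}) undefined (\<lambda>_. ?V); return_pmf (H w d t (y(k := x)))}"
  proof (intro bind_pmf_cong refl, clarify)
    fix w d assume wd: "(w, d) \<in> set_pmf p"
    show "do {T \<leftarrow> Pi_pmf ?A undefined (\<lambda>_. ?U);
        y \<leftarrow> Pi_pmf ?A undefined (\<lambda>j. scheme_query F \<alpha> m j (d j) (?R w j (T j)));
        return_pmf (H w d (T k) y)} =
      do {t \<leftarrow> ?U; x \<leftarrow> scheme_query F \<alpha> m k (d k) (?R w k t);
        y \<leftarrow> Pi_pmf (?A - {k}) undefined (\<lambda>_. ?V); return_pmf (H w d t (y(k := x)))}"
      \<comment> \<open>Averaging over the connection of each other reducer makes its query uniform,
        so the laws \<open>V j\<close> are the same for all \<open>d\<close> and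
        \<open>w\<close>.\<close>
      using k scheme_query_uniform demand_in[OF wd]
      by (intro Pi_pmf_bind_split[where \<kappa> = "\<lambda>j T. scheme_query F \<alpha> m j (d j) (?R w j T)"]) simp_all
  qed
  also have "\<dots> = bind_pmf \<mu> (\<lambda>a. map_pmf (Pair a) (g (snd a)))"
    unfolding \<mu>_def g_def H_def
    by (simp add: bind_assoc_pmf bind_return_pmf map_bind_pmf split_def)
  finally show "map_pmf (\<lambda>\<omega>. ((\<lambda>j\<in>?A. demand \<omega> j, demand \<omega> k, known_batches K F m k \<omega>),
      \<lambda>j\<in>?A. query \<omega> j)) scheme_law = bind_pmf \<mu> (\<lambda>a. map_pmf (Pair a) (g (snd a)))" .
qed

section \<open>The two loads\<close>

lemma scheme_computation_load: "computation_load K F m = 1"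
proof -
  have "(\<Sum>k\<in>{1..K}. \<Sum>f\<in>{1..F}. card (batch m k f)) = K * F * (n_files m div (K * F))"
    by (simp add: batch_card)
  also have "\<dots> = n_files m" using n_files_dvd by simp
  finally show ?thesis using n_files_pos by (simp add: computation_load_def)
qed

text \<open>Each of the \<open>K\<close> reducers sends \<open>?S\<close> packets of
  \<open>?N * ?\<beta> / (K * F * (K - 1))\<close> bits, so the load is
  \<open>?S / (?Q * F * (K - 1))\<close>.\<close>

lemma scheme_communication_load:
  "communication_load K m (scheme_message K F \<alpha> m) \<omega> =
     (real F - real \<alpha>) / (real F * (real K - 1) * (real \<alpha> + 1))"
proof -
  let ?Q = "real (F choose \<alpha>)" and ?S = "real (F choose Suc \<alpha>)"
    and ?N = "real (n_files m)" and ?\<beta> = "real (iv_len m)"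
  have F: "\<alpha> < F" using \<alpha> by auto
  have Q0: "?Q > 0" using F by simp
  \<comment> \<open>Both sides equal \<open>F * ((F - 1) choose \<alpha>)\<close>; this gives the
    ratio of \<open>?S\<close> to \<open>?Q\<close>.\<close>
  have "Suc \<alpha> * (F choose Suc \<alpha>) = (F - \<alpha>) * (F choose \<alpha>)"
    by (simp only: binomial_absorption binomial_absorb_comp)
  then have S: "(real \<alpha> + 1) * ?S = (real F - real \<alpha>) * ?Q"
    using F by (metis of_nat_mult of_nat_Suc of_nat_diff less_imp_le add.commute)
  \<comment> \<open>Both divisions in \<open>packet_len\<close> are exact by the divisibility
    hypotheses, so no bits are lost to rounding.\<close>
  have "real ((K - 1) * plen * (K * F)) = real (n_files m * iv_len m)"
  proof -
    have "n_files m div (K * F) * iv_len m * (K * F) = n_files m div (K * F) * (K * F) * iv_len m"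
      by (simp only: ac_simps)
    then show ?thesis unfolding packet_len_eq dvd_div_mult_self[OF n_files_dvd] by (rule arg_cong)
  qed
  then have len: "(real K - 1) * real plen * (real K * real F) = ?N * ?\<beta>"
    using K by (simp add: of_nat_diff)
  have "(\<Sum>k\<in>{1..K}. length (concat (scheme_message K F \<alpha> m k \<omega>))) = K * ((F choose Suc \<alpha>) * plen)"
    by (simp only: length_scheme_message sum_constant card_atLeastAtMost cong: sum.cong) simp
  then have "communication_load K m (scheme_message K F \<alpha> m) \<omega> =
      (real K * ?S * real plen) / (?Q * (?N * ?\<beta>))"
    by (simp add: communication_load_def Q)
  also have "\<dots> = (real F - real \<alpha>) / (real F * (real K - 1) * (real \<alpha> + 1))"
  proof -
    have nz: "?Q * (?N * ?\<beta>) \<noteq> 0" "real F * (real K - 1) * (real \<alpha> + 1) \<noteq> 0"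
      using Q0 n_files_pos iv_len_pos F K by auto
    have "(real K * ?S * real plen) * (real F * (real K - 1) * (real \<alpha> + 1)) =
        ((real \<alpha> + 1) * ?S) * ((real K - 1) * real plen * (real K * real F))"
      by (simp add: algebra_simps)
    also have "\<dots> = (real F - real \<alpha>) * (?Q * (?N * ?\<beta>))"
      unfolding S len by simp
    finally show ?thesis using nz by (simp add: frac_eq_eq)
  qed
  finally show ?thesis .
qed

end

theorem theorem1:
  fixes K F \<alpha> :: nat
    and m :: "('w::{field,finite}, 'v::{field,finite}, 'o::{field,finite}) madc"
    and p :: "((nat \<Rightarrow> 'w) \<times> (nat \<Rightarrow> nat)) pmf"
  assumes "K > 1" and "F > 0" and "\<alpha> \<in> {1..F - 1}"
    and "ppma_madc K F m"
    and "n_funcs m = F choose \<alpha>"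
    and "(K - 1) dvd n_files m div (K * F) * iv_len m"
    and "set_pmf p \<subseteq> ({1..n_files m} \<rightarrow>\<^sub>E UNIV) \<times> ({1..K} \<rightarrow>\<^sub>E {1..n_funcs m})"
  defines "X \<equiv> scheme_message K F \<alpha> m"
    and "law \<equiv> joint_law K F \<alpha> m (scheme_query F \<alpha> m) p"
  shows "is_pda (K * (F choose \<alpha>)) (K * F) ((K - 1) * F + \<alpha>) (F choose (\<alpha> + 1)) (P_array F \<alpha>)
    \<and> corresponds K F \<alpha> m (P_array F \<alpha>)
    \<and> encoding_req K F m law X
    \<and> decoding_req K F m law X
    \<and> privacy_req K F m law
    \<and> computation_load K F m = 1
    \<and> (\<forall>\<omega>\<in>set_pmf law. communication_load K m X \<omega> =
          (real F - real \<alpha>) / (real F * (real K - 1) * (real \<alpha> + 1)))"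
  unfolding X_def law_def Suc_eq_plus1[symmetric]
  using P_array_is_pda[of K F \<alpha>] P_array_corresponds[OF assms(5), of K]
    scheme_encoding[OF assms(1,3-7)] scheme_decoding[OF assms(1,3-7)]
    scheme_privacy[OF assms(1,3-7)] scheme_computation_load[OF assms(1,3-7)]
    scheme_communication_load[OF assms(1,3-7)] assms(1)
  by blast

end
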